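(* Let $G$ be a finite group. Then the following are equivalent. (1) If $G$ is a non-abelian simple group, then $|G|$ is even. (2) If $|G|$ is odd, then $|\Omega(G)^\times| = 2$. (3) If $|G|$ is odd, then $\Omega(G)^\times \simeq \Omega(G, \mathrm{NS}(G))^\times$. (4) If $|G|$ is odd, then $\Omega(G)^\times \simeq \Omega(G, \mathrm{Sub}(G)_{G'})^\times$. Here $\mathrm{NS}(G)$ is the set of all normal subgroups of $G$, $G'$ is the commutator subgroup of $G$, and $\mathrm{Sub}(G)_{G'} = \{H \leq G \mid G' \leq H\}$.
   Context: For a finite group $G$, the Burnside ring $\Omega(G)$ is the Grothendieck ring of the semiring of isomorphism classes of finite left $G$-sets, with addition given by disjoint union and multiplication by Cartesian product. It is a free abelian group with basis the classes $[G/H]$, where $H$ runs over representatives of the conjugacy classes of subgroups of $G$. A collection of $G$ is a family $\mathcal{D}$ of subgroups of $G$ with $G \in \mathcal{D}$ that is closed under $G$-conjugation and under intersection of two members. For a collection $\mathcal{D}$ of $G$, the partial Burnside ring $\Omega(G,\mathcal{D})$ is the $\mathbb{Z}$-span of $\{[G/H] \mid H \in \mathcal{D}\}$ in $\Omega(G)$; it is a unital subring of $\Omega(G)$. For a ring $R$, $R^\times$ denotes its group of units; $\simeq$ between unit groups denotes isomorphism of groups. *)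

theory Defs
  imports
    "HOL-Algebra.Group_Action"
    "HOL-Algebra.Left_Coset"
    "HOL-Algebra.Generated_Groups"
    "HOL-Algebra.SimpleGroups"
    "HOL-Algebra.Ring"
begin

section \<open>Finite G-sets\<close>

text \<open>A left \<open>G\<close>-set is a pair \<open>(S, \<phi>)\<close> of a set and an action in the sense of \<^locale>\<open>group_action\<close>.
  The values of \<open>\<phi>\<close> outside \<^term>\<open>carrier G\<close> are irrelevant, and \<open>gset_iso\<close> ignores them.\<close>

type_synonym ('a, 'x) gset = "'x set \<times> ('a \<Rightarrow> 'x \<Rightarrow> 'x)"

definition finite_gset :: "('a, 'm) monoid_scheme \<Rightarrow> ('a, 'x) gset \<Rightarrow> bool" where
  "finite_gset G S \<longleftrightarrow> group_action G (fst S) (snd S) \<and> finite (fst S)"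

definition gset_iso :: "('a, 'm) monoid_scheme \<Rightarrow> ('a, 'x) gset \<Rightarrow> ('a, 'y) gset \<Rightarrow> bool" where
  "gset_iso G S T \<longleftrightarrow>
     (\<exists>f. bij_betw f (fst S) (fst T) \<and>
          (\<forall>g\<in>carrier G. \<forall>x\<in>fst S. f (snd S g x) = snd T g (f x)))"

definition gset_sum :: "('a, 'x) gset \<Rightarrow> ('a, 'y) gset \<Rightarrow> ('a, 'x + 'y) gset" where
  "gset_sum S T =
     (fst S <+> fst T, \<lambda>g. \<lambda>z\<in>fst S <+> fst T. map_sum (snd S g) (snd T g) z)"

definition gset_prod :: "('a, 'x) gset \<Rightarrow> ('a, 'y) gset \<Rightarrow> ('a, 'x \<times> 'y) gset" where
  "gset_prod S T =
     (fst S \<times> fst T, \<lambda>g. \<lambda>z\<in>fst S \<times> fst T. map_prod (snd S g) (snd T g) z)"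

definition coset_gset :: "('a, 'm) monoid_scheme \<Rightarrow> 'a set \<Rightarrow> ('a, 'a set) gset" where
  "coset_gset G H = (lcosets\<^bsub>G\<^esub> H, \<lambda>g. \<lambda>C\<in>lcosets\<^bsub>G\<^esub> H. g <#\<^bsub>G\<^esub> C)"


section \<open>The semiring of isomorphism classes\<close>

text \<open>Every finite \<open>G\<close>-set is isomorphic to one whose points are natural numbers. Hence
  isomorphism classes are represented as sets of \<open>G\<close>-sets over \<^typ>\<open>nat\<close>; the class is
  nevertheless defined for a \<open>G\<close>-set over an arbitrary type.\<close>

definition gset_class ::
  "('a, 'm) monoid_scheme \<Rightarrow> ('a, 'x) gset \<Rightarrow> ('a, nat) gset set" where
  "gset_class G S = {U. finite_gset G U \<and> gset_iso G U S}"

definition gset_semiring :: "('a, 'm) monoid_scheme \<Rightarrow> ('a, nat) gset set ring" where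
  "gset_semiring G =
     \<lparr>carrier = gset_class G ` {S :: ('a, nat) gset. finite_gset G S},
      monoid.mult = \<lambda>A B. \<Union>S\<in>A. \<Union>T\<in>B. gset_class G (gset_prod S T),
      one = gset_class G ({()}, \<lambda>g. \<lambda>x\<in>{()}. x),
      zero = gset_class G ({} :: nat set, \<lambda>g. \<lambda>x\<in>{}. x),
      add = \<lambda>A B. \<Union>S\<in>A. \<Union>T\<in>B. gset_class G (gset_sum S T)\<rparr>"


section \<open>The Grothendieck ring of a commutative semiring\<close>

text \<open>The pair \<open>(a, b)\<close> stands for the formal difference \<open>a - b\<close>.\<close>

definition grothendieck_rel :: "('b, 'm) ring_scheme \<Rightarrow> (('b \<times> 'b) \<times> ('b \<times> 'b)) set" where
  "grothendieck_rel R =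
     {((a, b), (c, d)) | a b c d. {a, b, c, d} \<subseteq> carrier R \<and>
        (\<exists>e\<in>carrier R. a \<oplus>\<^bsub>R\<^esub> d \<oplus>\<^bsub>R\<^esub> e = c \<oplus>\<^bsub>R\<^esub> b \<oplus>\<^bsub>R\<^esub> e)}"

definition grothendieck_ring :: "('b, 'm) ring_scheme \<Rightarrow> ('b \<times> 'b) set ring" where
  "grothendieck_ring R =
     \<lparr>carrier = (carrier R \<times> carrier R) // grothendieck_rel R,
      monoid.mult = \<lambda>P Q. \<Union>(a, b)\<in>P. \<Union>(c, d)\<in>Q.
        grothendieck_rel R ``
          {(a \<otimes>\<^bsub>R\<^esub> c \<oplus>\<^bsub>R\<^esub> b \<otimes>\<^bsub>R\<^esub> d, a \<otimes>\<^bsub>R\<^esub> d \<oplus>\<^bsub>R\<^esub> b \<otimes>\<^bsub>R\<^esub> c)},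
      one = grothendieck_rel R `` {(\<one>\<^bsub>R\<^esub>, \<zero>\<^bsub>R\<^esub>)},
      zero = grothendieck_rel R `` {(\<zero>\<^bsub>R\<^esub>, \<zero>\<^bsub>R\<^esub>)},
      add = \<lambda>P Q. \<Union>(a, b)\<in>P. \<Union>(c, d)\<in>Q.
        grothendieck_rel R `` {(a \<oplus>\<^bsub>R\<^esub> c, b \<oplus>\<^bsub>R\<^esub> d)}\<rparr>"

definition grothendieck_embed :: "('b, 'm) ring_scheme \<Rightarrow> 'b \<Rightarrow> ('b \<times> 'b) set" where
  "grothendieck_embed R a = grothendieck_rel R `` {(a, \<zero>\<^bsub>R\<^esub>)}"


section \<open>Burnside rings\<close>

type_synonym 'a burnside = "(('a, nat) gset set \<times> ('a, nat) gset set) set"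

definition burnside_ring :: "('a, 'm) monoid_scheme \<Rightarrow> 'a burnside ring" where
  "burnside_ring G = grothendieck_ring (gset_semiring G)"

definition burnside_basis :: "('a, 'm) monoid_scheme \<Rightarrow> 'a set \<Rightarrow> 'a burnside" where
  "burnside_basis G H =
     grothendieck_embed (gset_semiring G) (gset_class G (coset_gset G H))"

text \<open>The \<open>\<int>\<close>-span is the additive subgroup generated by the given classes. It is a subring
  when \<open>\<D>\<close> is a collection of \<open>G\<close>: a family of subgroups that contains \<^term>\<open>carrier G\<close> and
  is closed under conjugation and under intersection of two members. Both families below are
  collections.\<close>

definition partial_burnside_ring ::
  "('a, 'm) monoid_scheme \<Rightarrow> 'a set set \<Rightarrow> 'a burnside ring" where
  "partial_burnside_ring G \<D> =
     (burnside_ring G)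
       \<lparr>carrier := generate (add_monoid (burnside_ring G)) (burnside_basis G ` \<D>)\<rparr>"

definition normal_subgroups :: "('a, 'm) monoid_scheme \<Rightarrow> 'a set set" where
  "normal_subgroups G = {N. N \<lhd> G}"

definition subgroups_over_derived :: "('a, 'm) monoid_scheme \<Rightarrow> 'a set set" where
  "subgroups_over_derived G = {H. subgroup H G \<and> derived G (carrier G) \<subseteq> H}"

end

theory Submission
  imports Defs "HOL-Algebra.Weak_Morphisms" "HOL-Algebra.Sylow" "HOL-Library.Function_Algebras"
begin

text \<open>
  Let \<open>X\<close> be a finite \<open>G\<close>-set. Its \<^emph>\<open>marks\<close> are the numbers of fixed points of the subgroups of
  \<open>G\<close>. Marks turn disjoint unions into sums and products into products, and they determine \<open>X\<close> up
  to isomorphism (\<open>gset_iso_if_marks_eq\<close>). So the Burnside ring is the ring of differences of mark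
  functions, with pointwise operations, and its units have all values \<open>1\<close> or \<open>- 1\<close>.

  The Cauchy--Frobenius lemma, for a group \<open>L\<close> that normalises \<open>H\<close> and acts on the fixed points of
  \<open>H\<close>, shows that a difference \<open>f\<close> of marks satisfies Burnside's congruences: \<open>\<bar>L\<bar>\<close> divides the sum
  of \<open>f \<langle>g, H\<rangle>\<close> over \<open>g \<in> L\<close> (\<open>mark_congruence\<close>). Conversely, a class function on subgroups that
  satisfies the congruences is a difference of marks (\<open>differences_eq_ghost\<close>). Each half gives one
  half of the equivalence.

  \<^item> If \<open>H\<close> is normal in \<open>L\<close> with prime index \<open>p\<close>, then the congruence says \<open>f H \<equiv> f L\<close> modulo \<open>p\<close>.
    For \<open>\<bar>G\<bar>\<close> odd, a unit thus has the same value at \<open>H\<close> and at \<open>L\<close>. If no simple group of odd order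
    is non-abelian, then every non-trivial subgroup has a normal subgroup of prime index, so units
    are constant, and \<open>1\<close> and \<open>- 1\<close> are the only ones (\<open>burnside_units_trivial\<close>).

  \<^item> If \<open>G\<close> is simple and non-abelian, then a proper subgroup \<open>H\<close> together with one element of its
    normaliser never generates \<open>G\<close>. So the function \<open>e\<close> that is \<open>1\<close> at \<open>G\<close> and \<open>0\<close> at proper
    subgroups satisfies the congruences. It is an idempotent of the Burnside ring, and \<open>1 - 2 e\<close> is
    a third unit (\<open>nontrivial_unit\<close>).

  For such a simple \<open>G\<close> of odd order, the normal subgroups are \<open>G\<close> and the trivial group, and \<open>G\<close>
  is the only subgroup above \<open>G'\<close>. An element \<open>a + b [G/1]\<close> has mark \<open>a\<close> at \<open>G\<close> and \<open>a + b \<bar>G\<bar>\<close> at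
  the trivial group, so as \<open>\<bar>G\<bar> > 2\<close> it is a unit only for \<open>b = 0\<close> (\<open>partial_units_trivial\<close>). Hence neither
  partial Burnside ring has as many units as the full one. On the other hand, both partial rings
  contain \<open>1\<close> and \<open>- 1\<close>, so if the full ring has only two units, all three unit groups are equal.
\<close>

section \<open>Finite G-sets and their marks\<close>

lemma (in group) group_actionI:
  assumes ext: "\<And>g. g \<in> carrier G \<Longrightarrow> \<phi> g \<in> extensional E"
    and closed: "\<And>g x. g \<in> carrier G \<Longrightarrow> x \<in> E \<Longrightarrow> \<phi> g x \<in> E"
    and one: "\<And>x. x \<in> E \<Longrightarrow> \<phi> \<one> x = x"
    and mult: "\<And>g h x. g \<in> carrier G \<Longrightarrow> h \<in> carrier G \<Longrightarrow> x \<in> E \<Longrightarrow> \<phi> (g \<otimes> h) x = \<phi> g (\<phi> h x)"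
  shows "group_action G E \<phi>"
proof -
  have bij: "\<phi> g \<in> Bij E" if g: "g \<in> carrier G" for g
  proof -
    have "bij_betw (\<phi> g) E E"
    proof (rule bij_betwI[where g = "\<phi> (inv g)"])
      show "\<phi> g \<in> E \<rightarrow> E" "\<phi> (inv g) \<in> E \<rightarrow> E"
        using g closed by auto
      show "\<phi> (inv g) (\<phi> g x) = x" if "x \<in> E" for x
        using mult[of "inv g" g x] g one that by simp
      show "\<phi> g (\<phi> (inv g) x) = x" if "x \<in> E" for x
        using mult[of g "inv g" x] g one that by simp
    qed
    then show ?thesis
      using ext[OF g] by (simp add: Bij_def)
  qed
  have "\<phi> (g \<otimes> h) = compose E (\<phi> g) (\<phi> h)" if "g \<in> carrier G" "h \<in> carrier G" for g h
    by (rule extensionalityI[of _ E]) (use that ext mult in \<open>auto simp: compose_def\<close>)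
  then have "\<phi> \<in> hom G (BijGroup E)"
    using bij by (auto simp: hom_def BijGroup_def)
  then show ?thesis
    by (simp add: group_action_def group_hom_def group_hom_axioms_def group_BijGroup is_group)
qed

lemma finite_gsetD:
  assumes "finite_gset G S"
  shows gset_group: "group G"
    and gset_action: "group_action G (fst S) (snd S)"
    and gset_finite: "finite (fst S)"
    and gset_closed: "\<And>g x. g \<in> carrier G \<Longrightarrow> x \<in> fst S \<Longrightarrow> snd S g x \<in> fst S"
    and gset_one: "\<And>x. x \<in> fst S \<Longrightarrow> snd S \<one>\<^bsub>G\<^esub> x = x"
    and gset_mult: "\<And>g h x. g \<in> carrier G \<Longrightarrow> h \<in> carrier G \<Longrightarrow> x \<in> fst S \<Longrightarrow>
          snd S (g \<otimes>\<^bsub>G\<^esub> h) x = snd S g (snd S h x)"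
    and gset_inv: "\<And>g x. g \<in> carrier G \<Longrightarrow> x \<in> fst S \<Longrightarrow> snd S (inv\<^bsub>G\<^esub> g) (snd S g x) = x"
proof -
  show act: "group_action G (fst S) (snd S)" and "finite (fst S)"
    using assms by (auto simp: finite_gset_def)
  interpret group_action G "fst S" "snd S" by (rule act)
  show "group G"
    using group_hom group_hom.axioms(1) by blast
  show "snd S g x \<in> fst S" if "g \<in> carrier G" "x \<in> fst S" for g x
    using element_image[OF that] by simp
  show "snd S \<one>\<^bsub>G\<^esub> x = x" if "x \<in> fst S" for x
    using id_eq_one that by (metis restrict_apply')
  show "snd S (g \<otimes>\<^bsub>G\<^esub> h) x = snd S g (snd S h x)"
    if "g \<in> carrier G" "h \<in> carrier G" "x \<in> fst S" for g h x
    using composition_rule that by blast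
  show "snd S (inv\<^bsub>G\<^esub> g) (snd S g x) = x" if "g \<in> carrier G" "x \<in> fst S" for g x
    using orbit_sym_aux that by blast
qed

lemma (in group) finite_gsetI:
  assumes "finite E"
    and "\<And>g x. g \<in> carrier G \<Longrightarrow> x \<in> E \<Longrightarrow> \<phi> g x \<in> E"
    and "\<And>x. x \<in> E \<Longrightarrow> \<phi> \<one> x = x"
    and "\<And>g h x. g \<in> carrier G \<Longrightarrow> h \<in> carrier G \<Longrightarrow> x \<in> E \<Longrightarrow> \<phi> (g \<otimes> h) x = \<phi> g (\<phi> h x)"
  shows "finite_gset G (E, \<lambda>g. \<lambda>x\<in>E. \<phi> g x)"
  unfolding finite_gset_def fst_conv snd_conv
  by (intro conjI group_actionI) (use assms in auto)

lemma gset_isoI: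
  assumes "bij_betw f (fst S) (fst T)"
    and "\<And>g x. g \<in> carrier G \<Longrightarrow> x \<in> fst S \<Longrightarrow> f (snd S g x) = snd T g (f x)"
  shows "gset_iso G S T"
  using assms unfolding gset_iso_def by blast

lemma gset_isoE:
  assumes "gset_iso G S T"
  obtains f where "bij_betw f (fst S) (fst T)"
    and "\<And>g x. g \<in> carrier G \<Longrightarrow> x \<in> fst S \<Longrightarrow> f (snd S g x) = snd T g (f x)"
  using assms unfolding gset_iso_def by blast

lemma gset_iso_sym:
  assumes S: "finite_gset G S" and "gset_iso G S T"
  shows "gset_iso G T S"
proof -
  obtain f where f: "bij_betw f (fst S) (fst T)"
    and eq: "\<And>g x. g \<in> carrier G \<Longrightarrow> x \<in> fst S \<Longrightarrow> f (snd S g x) = snd T g (f x)"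
    using gset_isoE[OF assms(2)] by metis
  show ?thesis
  proof (rule gset_isoI)
    show "bij_betw (inv_into (fst S) f) (fst T) (fst S)"
      by (rule bij_betw_inv_into[OF f])
    fix g y assume g: "g \<in> carrier G" and "y \<in> fst T"
    then obtain x where x: "x \<in> fst S" "y = f x"
      using f by (auto simp: bij_betw_def)
    have "inj_on f (fst S)"
      using f by (simp add: bij_betw_def)
    then show "inv_into (fst S) f (snd T g y) = snd S g (inv_into (fst S) f y)"
      using x g eq[OF g x(1)] gset_closed[OF S g x(1)] by (metis inv_into_f_f)
  qed
qed

text \<open>Isomorphism classes consist of \<open>G\<close>-sets over \<^typ>\<open>nat\<close>; this makes the class of a \<open>G\<close>-set over
  any other type non-empty.\<close>

lemma gset_over_nat:
  fixes S :: "('a, 'x) gset"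
  assumes S: "finite_gset G S"
  shows "\<exists>U :: ('a, nat) gset. finite_gset G U \<and> gset_iso G U S"
proof -
  interpret group G by (rule gset_group[OF S])
  obtain f :: "'x \<Rightarrow> nat" where f: "inj_on f (fst S)"
    using finite_imp_inj_to_nat_seg[OF gset_finite[OF S]] by blast
  let ?i = "inv_into (fst S) f"
  let ?U = "(f ` fst S, \<lambda>g. \<lambda>y\<in>f ` fst S. f (snd S g (?i y)))"
  have "finite_gset G ?U"
    by (rule finite_gsetI)
       (use f gset_finite[OF S] gset_closed[OF S] gset_one[OF S] gset_mult[OF S] in auto)
  moreover have "gset_iso G S ?U"
    by (rule gset_isoI[where f = f]) (use f gset_closed[OF S] in \<open>auto simp: bij_betw_def\<close>)
  ultimately show ?thesis
    using gset_iso_sym[OF S] by blast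
qed

definition fixed_points :: "('a, 'm) monoid_scheme \<Rightarrow> ('a, 'x) gset \<Rightarrow> 'a set \<Rightarrow> 'x set" where
  "fixed_points G S A = {x \<in> fst S. \<forall>g \<in> A \<inter> carrier G. snd S g x = x}"

text \<open>Marks take arbitrary sets of group elements as arguments, so that an identity between
  marks is an equation in the ring of functions \<^typ>\<open>'a set \<Rightarrow> int\<close>, free of side conditions.\<close>

definition mark :: "('a, 'm) monoid_scheme \<Rightarrow> ('a, 'x) gset \<Rightarrow> 'a set \<Rightarrow> int" where
  "mark G S A = int (card (fixed_points G S A))"

lemma finite_fixed_points: "finite_gset G S \<Longrightarrow> finite (fixed_points G S A)"
  by (simp add: fixed_points_def gset_finite)

lemma mark_iso:
  assumes S: "finite_gset G S" and iso: "gset_iso G S T"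
  shows "mark G S = mark G T"
proof
  fix A
  obtain f where f: "bij_betw f (fst S) (fst T)"
    and eq: "\<And>g x. g \<in> carrier G \<Longrightarrow> x \<in> fst S \<Longrightarrow> f (snd S g x) = snd T g (f x)"
    using gset_isoE[OF iso] by metis
  have inj: "inj_on f (fst S)" and im: "f ` fst S = fst T"
    using f by (auto simp: bij_betw_def)
  have "snd T g (f x) = f x \<longleftrightarrow> snd S g x = x" if "g \<in> carrier G" "x \<in> fst S" for g x
    using eq[OF that] gset_closed[OF S that] inj that by (metis inj_onD)
  then have "f ` fixed_points G S A = fixed_points G T A"
    unfolding fixed_points_def im[symmetric] by auto
  moreover have "inj_on f (fixed_points G S A)"
    using inj by (rule inj_on_subset) (auto simp: fixed_points_def)
  ultimately show "mark G S A = mark G T A"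
    by (metis card_image mark_def)
qed

lemma (in group) finite_gset_sum:
  assumes S: "finite_gset G S" and T: "finite_gset G T"
  shows "finite_gset G (gset_sum S T)"
  unfolding gset_sum_def
  by (rule finite_gsetI)
     (use gset_finite[OF S] gset_finite[OF T] gset_closed[OF S] gset_closed[OF T]
        gset_one[OF S] gset_one[OF T] gset_mult[OF S] gset_mult[OF T] in auto)

lemma (in group) finite_gset_prod:
  assumes S: "finite_gset G S" and T: "finite_gset G T"
  shows "finite_gset G (gset_prod S T)"
  unfolding gset_prod_def
  by (rule finite_gsetI)
     (use gset_finite[OF S] gset_finite[OF T] gset_closed[OF S] gset_closed[OF T]
        gset_one[OF S] gset_one[OF T] gset_mult[OF S] gset_mult[OF T] in auto)

lemma mark_sum:
  assumes S: "finite_gset G S" and T: "finite_gset G T"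
  shows "mark G (gset_sum S T) = mark G S + mark G T"
proof
  fix A
  have "fixed_points G (gset_sum S T) A = fixed_points G S A <+> fixed_points G T A"
    by (auto simp: fixed_points_def gset_sum_def)
  then show "mark G (gset_sum S T) A = (mark G S + mark G T) A"
    using finite_fixed_points[OF S] finite_fixed_points[OF T] by (simp add: mark_def card_Plus)
qed

lemma mark_prod: "mark G (gset_prod S T) = mark G S * mark G T"
proof
  fix A
  have "fixed_points G (gset_prod S T) A = fixed_points G S A \<times> fixed_points G T A"
    by (auto simp: fixed_points_def gset_prod_def)
  then show "mark G (gset_prod S T) A = (mark G S * mark G T) A"
    by (simp add: mark_def card_cartesian_product)
qed

lemma (in group) finite_gset_point: "finite_gset G ({()}, \<lambda>g. \<lambda>x\<in>{()}. x)"
  by (rule finite_gsetI) auto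

lemma (in group) finite_gset_empty: "finite_gset G ({}, \<lambda>g. \<lambda>x\<in>{}. x)"
  by (rule finite_gsetI) auto

lemma mark_point: "mark G ({()}, \<lambda>g. \<lambda>x\<in>{()}. x) = 1"
proof -
  have "fixed_points G ({()}, \<lambda>g. \<lambda>x\<in>{()}. x) A = {()}" for A
    by (auto simp: fixed_points_def)
  then show ?thesis
    by (auto simp: mark_def fun_eq_iff)
qed

lemma mark_empty: "mark G ({}, \<lambda>g. \<lambda>x\<in>{}. x) = 0"
  by (auto simp: mark_def fixed_points_def fun_eq_iff)

lemma fixed_points_generate:
  assumes S: "finite_gset G S" and A: "A \<subseteq> carrier G"
  shows "fixed_points G S (generate G A) = fixed_points G S A"
proof -
  interpret group G by (rule gset_group[OF S])
  interpret group_action G "fst S" "snd S" by (rule gset_action[OF S])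
  have fix_iff: "x \<in> fixed_points G S B \<longleftrightarrow> x \<in> fst S \<and> B \<subseteq> stabilizer G (snd S) x"
    if "B \<subseteq> carrier G" for x B
    using that by (auto simp: fixed_points_def stabilizer_def)
  have "generate G A \<subseteq> stabilizer G (snd S) x \<longleftrightarrow> A \<subseteq> stabilizer G (snd S) x" if "x \<in> fst S" for x
    using generate_subgroup_incl[OF _ stabilizer_subgroup[OF that]] generate.incl[of _ A G] by blast
  then show ?thesis
    using fix_iff[OF A] fix_iff[OF generate_incl[OF A]] by blast
qed

lemma mark_generate:
  assumes "finite_gset G S"
  shows "mark G S (generate G (A \<inter> carrier G)) = mark G S A"
  using fixed_points_generate[OF assms, of "A \<inter> carrier G"]
  by (simp add: mark_def) (simp add: fixed_points_def)

lemma mark_conjugate: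
  fixes G (structure)
  assumes S: "finite_gset G S" and g: "g \<in> carrier G" and H: "H \<subseteq> carrier G"
  shows "mark G S ((\<lambda>h. g \<otimes> h \<otimes> inv g) ` H) = mark G S H"
proof -
  interpret group G by (rule gset_group[OF S])
  let ?C = "(\<lambda>h. g \<otimes> h \<otimes> inv g) ` H"
  have fixed: "snd S (g \<otimes> h \<otimes> inv g) (snd S g x) = snd S g (snd S h x)"
    if "h \<in> carrier G" "x \<in> fst S" for h x
    using that g gset_mult[OF S] gset_closed[OF S] gset_inv[OF S] by simp
  have inj: "inj_on (snd S g) (fst S)"
    using g gset_inv[OF S] by (metis inj_onI)
  have C: "?C \<subseteq> carrier G"
    using H g by auto
  have "snd S g ` fixed_points G S H = fixed_points G S ?C"
  proof (intro equalityI subsetI)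
    fix y assume "y \<in> snd S g ` fixed_points G S H"
    then show "y \<in> fixed_points G S ?C"
      using H g fixed gset_closed[OF S] by (auto simp: fixed_points_def)
  next
    fix y assume y: "y \<in> fixed_points G S ?C"
    then have yS: "y \<in> fst S"
      by (simp add: fixed_points_def)
    define x where "x = snd S (inv g) y"
    have x: "x \<in> fst S" "snd S g x = y"
      using yS g gset_closed[OF S] gset_inv[OF S, of "inv g" y] by (auto simp: x_def)
    have "snd S h x = x" if h: "h \<in> H" for h
    proof -
      have "snd S (g \<otimes> h \<otimes> inv g) y = y"
        using y h C by (auto simp: fixed_points_def)
      then have "snd S g (snd S h x) = snd S g x"
        using fixed[of h x] x h H by auto
      then show ?thesis
        using inj x(1) h H gset_closed[OF S] by (meson inj_onD subsetD)
    qed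
    then show "y \<in> snd S g ` fixed_points G S H"
      using x by (auto simp: fixed_points_def)
  qed
  moreover have "inj_on (snd S g) (fixed_points G S H)"
    using inj by (rule inj_on_subset) (auto simp: fixed_points_def)
  ultimately show ?thesis
    by (metis card_image mark_def)
qed

section \<open>Marks determine a finite G-set\<close>

definition sub_gset :: "('a, 'x) gset \<Rightarrow> 'x set \<Rightarrow> ('a, 'x) gset" where
  "sub_gset S E = (E, \<lambda>g. \<lambda>x\<in>E. snd S g x)"

lemma finite_sub_gset:
  assumes S: "finite_gset G S" and "E \<subseteq> fst S"
    and "\<And>g x. g \<in> carrier G \<Longrightarrow> x \<in> E \<Longrightarrow> snd S g x \<in> E"
  shows "finite_gset G (sub_gset S E)"
proof -
  interpret group G by (rule gset_group[OF S])
  show ?thesis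
    unfolding sub_gset_def
    by (rule finite_gsetI)
       (use assms finite_subset[OF assms(2) gset_finite[OF S]] gset_one[OF S] gset_mult[OF S] in auto)
qed

lemma mark_split:
  assumes S: "finite_gset G S" and E: "E \<subseteq> fst S"
  shows "mark G S A = mark G (sub_gset S E) A + mark G (sub_gset S (fst S - E)) A"
proof -
  have "fixed_points G S A =
      fixed_points G (sub_gset S E) A \<union> fixed_points G (sub_gset S (fst S - E)) A"
    using E by (auto simp: fixed_points_def sub_gset_def)
  moreover have "fixed_points G (sub_gset S E) A \<inter> fixed_points G (sub_gset S (fst S - E)) A = {}"
    by (auto simp: fixed_points_def sub_gset_def)
  ultimately show ?thesis
    using finite_fixed_points[OF S, of A] by (simp add: mark_def card_Un_disjoint)
qed

lemma gset_iso_combine: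
  assumes "gset_iso G (sub_gset S E) (sub_gset T F)"
    and "gset_iso G (sub_gset S (fst S - E)) (sub_gset T (fst T - F))"
    and "E \<subseteq> fst S" "F \<subseteq> fst T"
    and closed: "\<And>g x. g \<in> carrier G \<Longrightarrow> x \<in> E \<Longrightarrow> snd S g x \<in> E"
      "\<And>g x. g \<in> carrier G \<Longrightarrow> x \<in> fst S - E \<Longrightarrow> snd S g x \<in> fst S - E"
  shows "gset_iso G S T"
proof -
  obtain f where f: "bij_betw f E F"
    "\<And>g x. g \<in> carrier G \<Longrightarrow> x \<in> E \<Longrightarrow> f (snd S g x) = snd T g (f x)"
  proof -
    obtain f where f: "bij_betw f (E) (F)"
      "\<And>g x. g \<in> carrier G \<Longrightarrow> x \<in> E \<Longrightarrow>
        f ((\<lambda>x\<in>E. snd S g x) x) = (\<lambda>y\<in>F. snd T g y) (f x)"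
      using assms(1) unfolding gset_iso_def sub_gset_def fst_conv snd_conv by blast
    have "f (snd S g x) = snd T g (f x)" if "g \<in> carrier G" "x \<in> E" for g x
      using f(2)[OF that] bij_betwE[OF f(1)] that by simp
    then show thesis
      using f(1) that by blast
  qed
  obtain h where h: "bij_betw h (fst S - E) (fst T - F)"
    "\<And>g x. g \<in> carrier G \<Longrightarrow> x \<in> fst S - E \<Longrightarrow> h (snd S g x) = snd T g (h x)"
  proof -
    obtain f where f: "bij_betw f (fst S - E) (fst T - F)"
      "\<And>g x. g \<in> carrier G \<Longrightarrow> x \<in> fst S - E \<Longrightarrow>
        f ((\<lambda>x\<in>fst S - E. snd S g x) x) = (\<lambda>y\<in>fst T - F. snd T g y) (f x)"
      using assms(2) unfolding gset_iso_def sub_gset_def fst_conv snd_conv by blast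
    have "f (snd S g x) = snd T g (f x)" if "g \<in> carrier G" "x \<in> fst S - E" for g x
      using f(2)[OF that] bij_betwE[OF f(1)] that by simp
    then show thesis
      using f(1) that by blast
  qed
  let ?k = "\<lambda>x. if x \<in> E then f x else h x"
  have "bij_betw ?k (E \<union> (fst S - E)) (F \<union> (fst T - F))"
    by (rule bij_betw_disjoint_Un[OF f(1) h(1)]) auto
  then have "bij_betw ?k (fst S) (fst T)"
    using assms(3,4) by (simp add: Un_absorb1)
  then show ?thesis
    by (rule gset_isoI) (use f h closed in auto)
qed

lemma (in group_action) action_eq_iff:
  assumes "x \<in> E" "g \<in> carrier G" "h \<in> carrier G"
  shows "\<phi> g x = \<phi> h x \<longleftrightarrow> inv h \<otimes> g \<in> stabilizer G \<phi> x"
proof -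
  interpret group G using group_hom group_hom.axioms(1) by blast
  have "\<phi> (inv h \<otimes> g) x = \<phi> (inv h) (\<phi> g x)"
    using assms composition_rule by simp
  moreover have "\<phi> (inv h) (\<phi> g x) = x \<longleftrightarrow> \<phi> g x = \<phi> h x"
    by (metis assms element_image inv_closed inv_inv orbit_sym_aux)
  ultimately show ?thesis
    using assms by (simp add: stabilizer_def)
qed

text \<open>An orbit is determined by the stabilizer of one of its points: \<open>g x \<mapsto> g y\<close> is well defined and
  injective because \<open>g x = h x\<close> only depends on whether \<open>h\<inverse> g\<close> stabilizes \<open>x\<close>.\<close>

lemma orbit_iso:
  fixes G (structure)
  assumes S: "finite_gset G S" and T: "finite_gset G T" and x: "x \<in> fst S" and y: "y \<in> fst T"
    and stab: "stabilizer G (snd S) x = stabilizer G (snd T) y"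
  shows "gset_iso G (sub_gset S (orbit G (snd S) x)) (sub_gset T (orbit G (snd T) y))"
proof -
  interpret group G by (rule gset_group[OF S])
  interpret S: group_action G "fst S" "snd S" by (rule gset_action[OF S])
  interpret T: group_action G "fst T" "snd T" by (rule gset_action[OF T])
  define f where "f z = snd T (SOME g. g \<in> carrier G \<and> snd S g x = z) y" for z
  have same: "snd S g x = snd S h x \<longleftrightarrow> snd T g y = snd T h y"
    if "g \<in> carrier G" "h \<in> carrier G" for g h
    using S.action_eq_iff[OF x that] T.action_eq_iff[OF y that] stab by simp
  have f: "f (snd S g x) = snd T g y" if g: "g \<in> carrier G" for g
  proof -
    let ?h = "SOME h. h \<in> carrier G \<and> snd S h x = snd S g x"
    have "?h \<in> carrier G \<and> snd S ?h x = snd S g x"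
      by (rule someI[of "\<lambda>h. h \<in> carrier G \<and> snd S h x = snd S g x" g]) (simp add: g)
    then show ?thesis
      using same[of ?h g] g by (simp add: f_def)
  qed
  show ?thesis
  proof (rule gset_isoI[where f = f])
    show "bij_betw f (fst (sub_gset S (orbit G (snd S) x))) (fst (sub_gset T (orbit G (snd T) y)))"
      unfolding bij_betw_def inj_on_def sub_gset_def fst_conv orbit_def
      using f same by (force simp: image_def)
    fix g z assume g: "g \<in> carrier G" and "z \<in> fst (sub_gset S (orbit G (snd S) x))"
    then obtain h where h: "h \<in> carrier G" "z = snd S h x"
      by (auto simp: sub_gset_def orbit_def)
    have "snd S g z = snd S (g \<otimes> h) x" "snd T g (snd T h y) = snd T (g \<otimes> h) y"
      using g h x y gset_mult[OF S] gset_mult[OF T] by auto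
    then show "f (snd (sub_gset S (orbit G (snd S) x)) g z) =
        snd (sub_gset T (orbit G (snd T) y)) g (f z)"
      using f[of h] f[of "g \<otimes> h"] g h by (auto simp: sub_gset_def orbit_def)
  qed
qed

lemma orbit_closed:
  fixes G (structure)
  assumes S: "finite_gset G S" and x: "x \<in> fst S"
  shows "orbit G (snd S) x \<subseteq> fst S"
    and "\<And>g z. g \<in> carrier G \<Longrightarrow> z \<in> orbit G (snd S) x \<Longrightarrow> snd S g z \<in> orbit G (snd S) x"
    and "\<And>g z. g \<in> carrier G \<Longrightarrow> z \<in> fst S - orbit G (snd S) x \<Longrightarrow>
      snd S g z \<in> fst S - orbit G (snd S) x"
proof -
  interpret group G by (rule gset_group[OF S])
  show "orbit G (snd S) x \<subseteq> fst S"
    using gset_closed[OF S] x by (auto simp: orbit_def)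
  show closed: "snd S g z \<in> orbit G (snd S) x" if "g \<in> carrier G" "z \<in> orbit G (snd S) x" for g z
    using that gset_mult[OF S _ _ x, symmetric] by (auto simp: orbit_def)
  show "snd S g z \<in> fst S - orbit G (snd S) x"
    if "g \<in> carrier G" "z \<in> fst S - orbit G (snd S) x" for g z
    using closed[of "inv g" "snd S g z"] that gset_inv[OF S] gset_closed[OF S] by auto
qed

text \<open>Burnside's theorem. Take a point \<open>x\<close> of \<open>S\<close> whose stabilizer \<open>H\<close> is as large as possible. Equal
  marks at \<open>H\<close> give a point \<open>y\<close> of \<open>T\<close> that is fixed by \<open>H\<close>, and equal marks at the stabilizer of
  \<open>y\<close> give a point of \<open>S\<close> fixed by that stabilizer. By maximality the stabilizer of \<open>y\<close> is \<open>H\<close> too,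
  so the orbits of \<open>x\<close> and \<open>y\<close> are isomorphic. Remove them and repeat.\<close>

theorem (in group) gset_iso_if_marks_eq:
  fixes S :: "('a, 'x) gset" and T :: "('a, 'y) gset"
  assumes fin: "finite (carrier G)"
    and "finite_gset G S" "finite_gset G T" "mark G S = mark G T"
  shows "gset_iso G S T"
  using assms(2-)
proof (induction "card (fst S)" arbitrary: S T rule: less_induct)
  case less
  note S = \<open>finite_gset G S\<close> and T = \<open>finite_gset G T\<close>
  have marks: "card (fixed_points G S A) = card (fixed_points G T A)" for A
    using fun_cong[OF less.prems(3), of A] by (simp add: mark_def)
  interpret S: group_action G "fst S" "snd S" by (rule gset_action[OF S])
  interpret T: group_action G "fst T" "snd T" by (rule gset_action[OF T])
  show ?case
  proof (cases "fst S = {}")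
    case True
    then have "fst T = {}"
      using marks[of "{}"] gset_finite[OF T] by (simp add: fixed_points_def)
    then show ?thesis
      using True by (auto simp: gset_iso_def bij_betw_def)
  next
    case False
    have transfer: "\<exists>y\<in>fst T. stabilizer G (snd S) x \<subseteq> stabilizer G (snd T) y"
      if x: "x \<in> fst S" for x
    proof -
      have "x \<in> fixed_points G S (stabilizer G (snd S) x)"
        using x by (auto simp: fixed_points_def stabilizer_def)
      then have "card (fixed_points G S (stabilizer G (snd S) x)) > 0"
        using finite_fixed_points[OF S] by (auto simp: card_gt_0_iff)
      then have "fixed_points G T (stabilizer G (snd S) x) \<noteq> {}"
        unfolding marks by auto
      then obtain y where "y \<in> fixed_points G T (stabilizer G (snd S) x)"
        by blast
      then show ?thesis
        by (auto simp: fixed_points_def stabilizer_def)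
    qed
    have transfer': "\<exists>x\<in>fst S. stabilizer G (snd T) y \<subseteq> stabilizer G (snd S) x"
      if y: "y \<in> fst T" for y
    proof -
      have "y \<in> fixed_points G T (stabilizer G (snd T) y)"
        using y by (auto simp: fixed_points_def stabilizer_def)
      then have "card (fixed_points G T (stabilizer G (snd T) y)) > 0"
        using finite_fixed_points[OF T] by (auto simp: card_gt_0_iff)
      then have "fixed_points G S (stabilizer G (snd T) y) \<noteq> {}"
        unfolding marks[symmetric] by auto
      then obtain x where "x \<in> fixed_points G S (stabilizer G (snd T) y)"
        by blast
      then show ?thesis
        by (auto simp: fixed_points_def stabilizer_def)
    qed
    obtain x where x: "x \<in> fst S"
      and max: "\<And>z. z \<in> fst S \<Longrightarrow> card (stabilizer G (snd S) z) \<le> card (stabilizer G (snd S) x)"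
    proof -
      let ?M = "(\<lambda>z. card (stabilizer G (snd S) z)) ` fst S"
      have "finite ?M" "?M \<noteq> {}"
        using False gset_finite[OF S] by auto
      then obtain x where "x \<in> fst S" "card (stabilizer G (snd S) x) = Max ?M"
        using Max_in[of ?M] by (metis (no_types, lifting) imageE)
      then show thesis
        using Max_ge[OF \<open>finite ?M\<close>] that[of x] by simp
    qed
    obtain y where y: "y \<in> fst T" and xy: "stabilizer G (snd S) x \<subseteq> stabilizer G (snd T) y"
      using transfer[OF x] by blast
    obtain z where z: "z \<in> fst S" and yz: "stabilizer G (snd T) y \<subseteq> stabilizer G (snd S) z"
      using transfer'[OF y] by blast
    have "card (stabilizer G (snd T) y) \<le> card (stabilizer G (snd S) x)"
      using card_mono[OF finite_subset[OF S.stabilizer_subset fin] yz] max[OF z] by linarith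
    then have stab: "stabilizer G (snd S) x = stabilizer G (snd T) y"
      using card_seteq[OF finite_subset[OF T.stabilizer_subset fin] xy] by blast
    let ?O = "orbit G (snd S) x" and ?P = "orbit G (snd T) y"
    note O = orbit_closed[OF S x] and P = orbit_closed[OF T y]
    have iso: "gset_iso G (sub_gset S ?O) (sub_gset T ?P)"
      by (rule orbit_iso[OF S T x y stab])
    have S': "finite_gset G (sub_gset S (fst S - ?O))"
      by (rule finite_sub_gset[OF S _ O(3)]) simp_all
    have T': "finite_gset G (sub_gset T (fst T - ?P))"
      by (rule finite_sub_gset[OF T _ P(3)]) simp_all
    have "mark G (sub_gset S ?O) = mark G (sub_gset T ?P)"
      by (rule mark_iso[OF finite_sub_gset[OF S O(1,2)] iso])
    then have eq: "mark G (sub_gset S (fst S - ?O)) = mark G (sub_gset T (fst T - ?P))"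
      using mark_split[OF S O(1)] mark_split[OF T P(1)] less.prems(3)
      by (metis add_left_cancel ext)
    have "x \<in> ?O"
      by (rule S.orbit_refl[OF x])
    then have "card (fst (sub_gset S (fst S - ?O))) < card (fst S)"
      using x gset_finite[OF S] by (auto simp: sub_gset_def intro!: psubset_card_mono)
    then have "gset_iso G (sub_gset S (fst S - ?O)) (sub_gset T (fst T - ?P))"
      by (rule less.hyps[OF _ S' T' eq])
    with iso show ?thesis
      by (rule gset_iso_combine[OF _ _ O(1) P(1) O(2,3)])
  qed
qed

section \<open>The Grothendieck ring of a cancellative semiring\<close>

text \<open>A semiring that embeds into a commutative ring is cancellative, so two formal differences are
  equivalent exactly if they have the same value in the ring. The Grothendieck ring is then the
  subring of these values.\<close>

locale semiring_embedding =
  fixes R :: "('b, 'm) ring_scheme" (structure) and c :: "'b \<Rightarrow> 'r::comm_ring_1"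
  assumes zero_closed: "\<zero> \<in> carrier R" and one_closed: "\<one> \<in> carrier R"
    and add_closed: "a \<in> carrier R \<Longrightarrow> b \<in> carrier R \<Longrightarrow> a \<oplus> b \<in> carrier R"
    and mult_closed: "a \<in> carrier R \<Longrightarrow> b \<in> carrier R \<Longrightarrow> a \<otimes> b \<in> carrier R"
    and inj: "inj_on c (carrier R)"
    and c_zero: "c \<zero> = 0" and c_one: "c \<one> = 1"
    and c_add: "a \<in> carrier R \<Longrightarrow> b \<in> carrier R \<Longrightarrow> c (a \<oplus> b) = c a + c b"
    and c_mult: "a \<in> carrier R \<Longrightarrow> b \<in> carrier R \<Longrightarrow> c (a \<otimes> b) = c a * c b"
begin

abbreviation "K \<equiv> grothendieck_ring R"

definition differences :: "'r set" where
  "differences = {c a - c b | a b. a \<in> carrier R \<and> b \<in> carrier R}"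

text \<open>The element of the Grothendieck ring whose value is \<open>v\<close>; it is empty if \<open>v\<close> is not a difference.\<close>

definition diff_class :: "'r \<Rightarrow> ('b \<times> 'b) set" where
  "diff_class v = {(a, b). a \<in> carrier R \<and> b \<in> carrier R \<and> c a - c b = v}"

lemma rel_iff:
  "((a, b), (a', b')) \<in> grothendieck_rel R \<longleftrightarrow>
     a \<in> carrier R \<and> b \<in> carrier R \<and> a' \<in> carrier R \<and> b' \<in> carrier R \<and> c a - c b = c a' - c b'"
proof -
  have "a \<oplus> b' \<oplus> e = a' \<oplus> b \<oplus> e \<longleftrightarrow> c a - c b = c a' - c b'"
    if "a \<in> carrier R" "b \<in> carrier R" "a' \<in> carrier R" "b' \<in> carrier R" "e \<in> carrier R" for e
  proof -
    have "a \<oplus> b' \<oplus> e = a' \<oplus> b \<oplus> e \<longleftrightarrow> c (a \<oplus> b' \<oplus> e) = c (a' \<oplus> b \<oplus> e)"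
      using that by (intro inj_on_eq_iff[OF inj, symmetric] add_closed)
    also have "\<dots> \<longleftrightarrow> c a - c b = c a' - c b'"
      using that by (simp add: c_add add_closed algebra_simps)
    finally show ?thesis .
  qed
  then show ?thesis
    unfolding grothendieck_rel_def using zero_closed by auto
qed

lemma rel_Image:
  assumes "a \<in> carrier R" "b \<in> carrier R"
  shows "grothendieck_rel R `` {(a, b)} = diff_class (c a - c b)"
  unfolding diff_class_def using assms by (auto simp: rel_iff)

lemma differencesE:
  assumes "v \<in> differences"
  obtains a b where "a \<in> carrier R" "b \<in> carrier R" "c a - c b = v"
  using assms by (auto simp: differences_def)

lemma diff_class_nonempty: "v \<in> differences \<Longrightarrow> diff_class v \<noteq> {}"
  by (auto simp: diff_class_def differences_def)

lemma carrier_eq: "carrier K = diff_class ` differences"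
proof -
  have "differences = (\<lambda>(a, b). c a - c b) ` (carrier R \<times> carrier R)"
    by (auto simp: differences_def)
  then show ?thesis
    unfolding grothendieck_ring_def quotient_def by (force simp: rel_Image)
qed

lemma inj_diff_class: "inj_on diff_class differences"
proof
  fix v w assume "v \<in> differences" "w \<in> differences" and eq: "diff_class v = diff_class w"
  then obtain a b where "(a, b) \<in> diff_class v"
    using diff_class_nonempty by fastforce
  then show "v = w"
    using eq unfolding diff_class_def by auto
qed

text \<open>The operations of the Grothendieck ring are unions over all pairs of representatives; they
  collapse as soon as the result only depends on the values.\<close>

lemma UN_diff_class:
  assumes v: "v \<in> differences" and w: "w \<in> differences"
    and F: "\<And>a b a' b'. a \<in> carrier R \<Longrightarrow> b \<in> carrier R \<Longrightarrow> a' \<in> carrier R \<Longrightarrow> b' \<in> carrier R \<Longrightarrow>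
      c a - c b = v \<Longrightarrow> c a' - c b' = w \<Longrightarrow> F a b a' b' = X"
  shows "(\<Union>(a, b)\<in>diff_class v. \<Union>(a', b')\<in>diff_class w. F a b a' b') = X"
proof -
  have "(\<Union>(a', b')\<in>diff_class w. F a b a' b') = X" if "(a, b) \<in> diff_class v" for a b
    using F that diff_class_nonempty[OF w] unfolding diff_class_def by auto
  then have "(\<Union>(a, b)\<in>diff_class v. \<Union>(a', b')\<in>diff_class w. F a b a' b') = (\<Union>p\<in>diff_class v. X)"
    by (intro SUP_cong refl) (clarsimp simp only: split_paired_all prod.case)
  also have "\<dots> = X"
    using diff_class_nonempty[OF v] by auto
  finally show ?thesis .
qed

lemma differences_add:
  assumes "v \<in> differences" "w \<in> differences"
  shows "v + w \<in> differences"
proof -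
  obtain a b a' b' where ab: "a \<in> carrier R" "b \<in> carrier R" "a' \<in> carrier R" "b' \<in> carrier R"
    "c a - c b = v" "c a' - c b' = w"
    using differencesE[OF assms(1)] differencesE[OF assms(2)] by metis
  have "v + w = c (a \<oplus> a') - c (b \<oplus> b')"
    using ab by (auto simp: c_add)
  then show ?thesis
    unfolding differences_def using ab add_closed by blast
qed

lemma differences_mult:
  assumes "v \<in> differences" "w \<in> differences"
  shows "v * w \<in> differences"
proof -
  obtain a b a' b' where ab: "a \<in> carrier R" "b \<in> carrier R" "a' \<in> carrier R" "b' \<in> carrier R"
    "c a - c b = v" "c a' - c b' = w"
    using differencesE[OF assms(1)] differencesE[OF assms(2)] by metis
  have "v * w = c (a \<otimes> a' \<oplus> b \<otimes> b') - c (a \<otimes> b' \<oplus> b \<otimes> a')"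
    using ab by (auto simp: c_add c_mult mult_closed algebra_simps)
  then show ?thesis
    unfolding differences_def using ab add_closed mult_closed by blast
qed

lemma differences_uminus: "v \<in> differences \<Longrightarrow> - v \<in> differences"
  unfolding differences_def by (force simp: algebra_simps)

lemma c_in_differences: "a \<in> carrier R \<Longrightarrow> c a \<in> differences"
  unfolding differences_def using zero_closed c_zero by force

lemma one_in_differences: "1 \<in> differences"
  using c_in_differences[OF one_closed] c_one by simp

lemma zero_in_differences: "0 \<in> differences"
  using c_in_differences[OF zero_closed] c_zero by simp

lemma one_eq: "\<one>\<^bsub>K\<^esub> = diff_class 1"
  by (simp add: grothendieck_ring_def rel_Image one_closed zero_closed c_zero c_one)

lemma zero_eq: "\<zero>\<^bsub>K\<^esub> = diff_class 0"
  by (simp add: grothendieck_ring_def rel_Image one_closed zero_closed c_zero c_one)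

lemma embed_eq: "a \<in> carrier R \<Longrightarrow> grothendieck_embed R a = diff_class (c a)"
  by (simp add: grothendieck_embed_def rel_Image zero_closed c_zero)

lemma add_eq:
  assumes "v \<in> differences" "w \<in> differences"
  shows "diff_class v \<oplus>\<^bsub>K\<^esub> diff_class w = diff_class (v + w)"
  unfolding grothendieck_ring_def ring.simps
  by (rule UN_diff_class[OF assms]) (auto simp: rel_Image add_closed c_add algebra_simps)

lemma mult_eq:
  assumes "v \<in> differences" "w \<in> differences"
  shows "diff_class v \<otimes>\<^bsub>K\<^esub> diff_class w = diff_class (v * w)"
  unfolding grothendieck_ring_def monoid.simps
  by (rule UN_diff_class[OF assms])
     (auto simp: rel_Image add_closed mult_closed c_add c_mult algebra_simps)

lemma inv_add_eq:
  assumes v: "v \<in> differences"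
  shows "inv\<^bsub>add_monoid K\<^esub> diff_class v = diff_class (- v)"
  unfolding m_inv_def monoid.simps partial_object.simps
proof (rule the_equality)
  show "diff_class (- v) \<in> carrier K \<and> diff_class v \<oplus>\<^bsub>K\<^esub> diff_class (- v) = \<zero>\<^bsub>K\<^esub> \<and>
      diff_class (- v) \<oplus>\<^bsub>K\<^esub> diff_class v = \<zero>\<^bsub>K\<^esub>"
    using differences_uminus[OF v] v by (simp add: carrier_eq add_eq zero_eq)
next
  fix y assume y: "y \<in> carrier K \<and> diff_class v \<oplus>\<^bsub>K\<^esub> y = \<zero>\<^bsub>K\<^esub> \<and> y \<oplus>\<^bsub>K\<^esub> diff_class v = \<zero>\<^bsub>K\<^esub>"
  then obtain w where w: "w \<in> differences" "y = diff_class w"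
    by (auto simp: carrier_eq)
  then have "diff_class (v + w) = diff_class 0"
    using y v by (simp add: add_eq zero_eq)
  then have "v + w = 0"
    using inj_onD[OF inj_diff_class] differences_add[OF v w(1)] zero_in_differences by blast
  then show "y = diff_class (- v)"
    using w by (simp add: minus_unique)
qed

lemma diff_class_in_Units:
  assumes "v \<in> differences" "w \<in> differences" "v * w = 1"
  shows "diff_class v \<in> Units K"
proof -
  have "w * v = 1"
    using assms(3) by (simp add: mult.commute)
  then show ?thesis
    unfolding Units_def using assms by (auto simp: carrier_eq mult_eq one_eq intro!: bexI[of _ w])
qed

lemma UnitsE:
  assumes "x \<in> Units K"
  obtains v w where "v \<in> differences" "w \<in> differences" "v * w = 1" "x = diff_class v"
proof -
  obtain v w where vw: "v \<in> differences" "w \<in> differences" "x = diff_class v"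
    "diff_class (v * w) = diff_class 1"
    using assms unfolding Units_def by (auto simp: carrier_eq mult_eq one_eq)
  then have "v * w = 1"
    using inj_onD[OF inj_diff_class] differences_mult one_in_differences by blast
  then show thesis
    using that vw by blast
qed

text \<open>An upper bound for a \<open>\<int>\<close>-span: an additive group of values that contains the values of the
  generators contains the values of the span.\<close>

lemma generate_in_subgroup:
  assumes x: "x \<in> generate (add_monoid K) (diff_class ` B)"
    and B: "B \<subseteq> J" and J: "J \<subseteq> differences" "0 \<in> J"
    and add: "\<And>v w. v \<in> J \<Longrightarrow> w \<in> J \<Longrightarrow> v + w \<in> J" and uminus: "\<And>v. v \<in> J \<Longrightarrow> - v \<in> J"
  shows "x \<in> diff_class ` J"
  using x
proof (induction rule: generate.induct)
  case one
  then show ?case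
    using J by (simp add: zero_eq)
next
  case (incl h)
  then show ?case
    using B by auto
next
  case (inv h)
  then obtain v where "v \<in> J" "h = diff_class v"
    using B by blast
  moreover from this have "inv\<^bsub>add_monoid K\<^esub> h = diff_class (- v)"
    using J inv_add_eq by blast
  ultimately show ?case
    using uminus by (metis imageI)
next
  case (eng h1 h2)
  then obtain v w where "v \<in> J" "w \<in> J" "h1 = diff_class v" "h2 = diff_class w"
    by blast
  moreover from this have "h1 \<oplus>\<^bsub>K\<^esub> h2 = diff_class (v + w)"
    using J add_eq by blast
  ultimately show ?case
    using add by auto
qed

lemma generate_subset_carrier:
  assumes "B \<subseteq> differences"
  shows "generate (add_monoid K) (diff_class ` B) \<subseteq> carrier K"
proof
  fix x assume "x \<in> generate (add_monoid K) (diff_class ` B)"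
  then have "x \<in> diff_class ` differences"
    by (rule generate_in_subgroup[OF _ assms order_refl zero_in_differences
          differences_add differences_uminus])
  then show "x \<in> carrier K"
    by (simp add: carrier_eq)
qed

end

section \<open>The Burnside ring as a ring of marks\<close>

text \<open>All members of an isomorphism class have the same marks, so the choice is immaterial.\<close>

definition class_mark :: "('a, 'm) monoid_scheme \<Rightarrow> ('a, nat) gset set \<Rightarrow> 'a set \<Rightarrow> int" where
  "class_mark G A = mark G (SOME S. S \<in> A)"

locale finite_group = group +
  assumes fin: "finite (carrier G)"
begin

text \<open>By Burnside's theorem an isomorphism class is a fibre of the mark map. Class equality thus
  becomes an equation between functions, also for \<open>G\<close>-sets over different types.\<close>

lemma gset_class_eq:
  assumes "finite_gset G S"
  shows "gset_class G S = {U. finite_gset G U \<and> mark G U = mark G S}"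
  unfolding gset_class_def
  using mark_iso gset_iso_if_marks_eq[OF fin _ assms] by blast

lemma gset_class_cong:
  assumes "finite_gset G S" "finite_gset G T"
  shows "gset_class G S = gset_class G T \<longleftrightarrow> mark G S = mark G T"
proof
  assume eq: "gset_class G S = gset_class G T"
  obtain U :: "('a, nat) gset" where "finite_gset G U" "gset_iso G U S"
    using gset_over_nat[OF assms(1)] by blast
  moreover from this have "gset_iso G U T"
    using eq by (auto simp: gset_class_def)
  ultimately show "mark G S = mark G T"
    using mark_iso[of G U S] mark_iso[of G U T] by simp
next
  assume "mark G S = mark G T"
  then show "gset_class G S = gset_class G T"
    by (simp add: gset_class_eq[OF assms(1)] gset_class_eq[OF assms(2)])
qed

lemma class_mark:
  assumes S: "finite_gset G S"
  shows "class_mark G (gset_class G S) = mark G S"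
proof -
  obtain U :: "('a, nat) gset" where "U \<in> gset_class G S"
    using gset_over_nat[OF S] by (auto simp: gset_class_def)
  then have "(SOME U. U \<in> gset_class G S) \<in> gset_class G S"
    by (rule someI)
  then show ?thesis
    unfolding class_mark_def using gset_class_eq[OF S] by blast
qed

lemma gset_class_in_carrier:
  assumes S: "finite_gset G S"
  shows "gset_class G S \<in> carrier (gset_semiring G)"
proof -
  obtain U :: "('a, nat) gset" where U: "finite_gset G U" "gset_iso G U S"
    using gset_over_nat[OF S] by blast
  then have "gset_class G S = gset_class G U"
    using gset_class_cong[OF S U(1)] mark_iso[OF U] by simp
  then show ?thesis
    using U(1) by (auto simp: gset_semiring_def)
qed

lemma carrierE:
  assumes "A \<in> carrier (gset_semiring G)"
  obtains S :: "('a, nat) gset" where "finite_gset G S" "A = gset_class G S"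
  using assms by (auto simp: gset_semiring_def)

lemma UN_gset_class:
  assumes S: "finite_gset G S" and T: "finite_gset G T"
    and F: "\<And>U V :: ('a, nat) gset. finite_gset G U \<Longrightarrow> finite_gset G V \<Longrightarrow>
      mark G U = mark G S \<Longrightarrow> mark G V = mark G T \<Longrightarrow> F U V = X"
  shows "(\<Union>U\<in>gset_class G S. \<Union>V\<in>gset_class G T. F U V) = X"
proof -
  have ne: "gset_class G S \<noteq> {}" "gset_class G T \<noteq> {}"
    using gset_over_nat[OF S] gset_over_nat[OF T] by (auto simp: gset_class_def)
  have "(\<Union>U\<in>gset_class G S. \<Union>V\<in>gset_class G T. F U V) =
      (\<Union>U\<in>gset_class G S. \<Union>V\<in>gset_class G T. X)"
    by (intro SUP_cong refl) (use F gset_class_eq[OF S] gset_class_eq[OF T] in blast)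
  then show ?thesis
    using ne by simp
qed

lemma add_gset_class:
  assumes "finite_gset G S" "finite_gset G T"
  shows "gset_class G S \<oplus>\<^bsub>gset_semiring G\<^esub> gset_class G T = gset_class G (gset_sum S T)"
  unfolding gset_semiring_def ring.simps
  by (rule UN_gset_class[OF assms], subst gset_class_cong)
     (simp_all add: finite_gset_sum mark_sum assms)

lemma mult_gset_class:
  assumes "finite_gset G S" "finite_gset G T"
  shows "gset_class G S \<otimes>\<^bsub>gset_semiring G\<^esub> gset_class G T = gset_class G (gset_prod S T)"
  unfolding gset_semiring_def monoid.simps
  by (rule UN_gset_class[OF assms], subst gset_class_cong)
     (simp_all add: finite_gset_prod mark_prod assms)

text \<open>The semiring laws for classes of \<open>G\<close>-sets are inherited from the ring of functions on which the
  marks live, so no isomorphism for associativity or distributivity has to be constructed.\<close>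

sublocale burnside: semiring_embedding "gset_semiring G" "class_mark G"
proof
  have zero: "\<zero>\<^bsub>gset_semiring G\<^esub> = gset_class G ({} :: nat set, \<lambda>g. \<lambda>x\<in>{}. x)"
    and one: "\<one>\<^bsub>gset_semiring G\<^esub> = gset_class G ({()}, \<lambda>g. \<lambda>x\<in>{()}. x)"
    by (simp_all add: gset_semiring_def)
  show "\<zero>\<^bsub>gset_semiring G\<^esub> \<in> carrier (gset_semiring G)" "class_mark G \<zero>\<^bsub>gset_semiring G\<^esub> = 0"
    unfolding zero using gset_class_in_carrier finite_gset_empty class_mark mark_empty by metis+
  show "\<one>\<^bsub>gset_semiring G\<^esub> \<in> carrier (gset_semiring G)" "class_mark G \<one>\<^bsub>gset_semiring G\<^esub> = 1"
    unfolding one using gset_class_in_carrier finite_gset_point class_mark mark_point by metis+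
  show "inj_on (class_mark G) (carrier (gset_semiring G))"
  proof
    fix A B assume "A \<in> carrier (gset_semiring G)" "B \<in> carrier (gset_semiring G)"
      "class_mark G A = class_mark G B"
    then show "A = B"
      by (elim carrierE) (simp add: class_mark gset_class_cong)
  qed
  fix A B assume "A \<in> carrier (gset_semiring G)" "B \<in> carrier (gset_semiring G)"
  then obtain S T :: "('a, nat) gset" where "finite_gset G S" "finite_gset G T"
      "A = gset_class G S" "B = gset_class G T"
    by (elim carrierE)
  then show "A \<oplus>\<^bsub>gset_semiring G\<^esub> B \<in> carrier (gset_semiring G)"
      "class_mark G (A \<oplus>\<^bsub>gset_semiring G\<^esub> B) = class_mark G A + class_mark G B"
      "A \<otimes>\<^bsub>gset_semiring G\<^esub> B \<in> carrier (gset_semiring G)"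
      "class_mark G (A \<otimes>\<^bsub>gset_semiring G\<^esub> B) = class_mark G A * class_mark G B"
    by (simp_all add: add_gset_class mult_gset_class gset_class_in_carrier class_mark
        finite_gset_sum finite_gset_prod mark_sum mark_prod)
qed

lemma mark_in_differences: "finite_gset G S \<Longrightarrow> mark G S \<in> burnside.differences"
  using burnside.c_in_differences[OF gset_class_in_carrier] class_mark by metis

lemma ghostE:
  assumes "f \<in> burnside.differences"
  obtains S T :: "('a, nat) gset" where "finite_gset G S" "finite_gset G T" "f = mark G S - mark G T"
  using assms by (elim burnside.differencesE carrierE) (auto simp: class_mark)

end

section \<open>Burnside's congruences\<close>

context finite_group
begin

lemma generate_of_subgroup:
  assumes "subgroup H G" shows "generate G H = H"
  by (rule generateI[OF assms, symmetric]) (use assms in auto)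

text \<open>The group \<open>L\<close> acts on the fixed points of \<open>H\<close>. An element \<open>g\<close> of \<open>L\<close> fixes as many of them as there
  are fixed points of \<open>\<langle>g, H\<rangle>\<close>, and the Cauchy--Frobenius lemma identifies the sum of these numbers
  with \<open>\<bar>L\<bar>\<close> times the number of orbits.\<close>

lemma mark_congruence:
  assumes S: "finite_gset G S" and H: "H \<subseteq> carrier G" and L: "subgroup L G"
    and normal: "\<And>g h. g \<in> L \<Longrightarrow> h \<in> H \<Longrightarrow> inv g \<otimes> h \<otimes> g \<in> H"
  shows "int (card L) dvd (\<Sum>g\<in>L. mark G S (insert g H))"
proof -
  let ?L = "G\<lparr>carrier := L\<rparr>"
  let ?E = "fixed_points G S H"
  let ?\<phi> = "\<lambda>g. \<lambda>x\<in>?E. snd S g x"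
  note LG = subgroup.mem_carrier[OF L]
  interpret L: group ?L
    by (rule subgroup_imp_group[OF L])
  have E: "?E \<subseteq> fst S"
    by (auto simp: fixed_points_def)
  have closed: "snd S g x \<in> ?E" if g: "g \<in> L" and x: "x \<in> ?E" for g x
  proof -
    have "snd S h (snd S g x) = snd S g x" if h: "h \<in> H" for h
    proof -
      have hG: "h \<in> carrier G" and xS: "x \<in> fst S"
        using h H x E by auto
      have "snd S h (snd S g x) = snd S (h \<otimes> g) x"
        by (rule gset_mult[OF S hG LG[OF g] xS, symmetric])
      also have "h \<otimes> g = g \<otimes> (inv g \<otimes> h \<otimes> g)"
        using LG[OF g] hG by (simp add: m_assoc[symmetric])
      also have "snd S (g \<otimes> (inv g \<otimes> h \<otimes> g)) x = snd S g (snd S (inv g \<otimes> h \<otimes> g) x)"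
        by (rule gset_mult[OF S LG[OF g] _ xS]) (use LG[OF g] hG in simp)
      also have "snd S (inv g \<otimes> h \<otimes> g) x = x"
        using x normal[OF g h] H by (auto simp: fixed_points_def)
      finally show ?thesis .
    qed
    then show ?thesis
      using x gset_closed[OF S LG[OF g]] by (auto simp: fixed_points_def)
  qed
  have "finite_gset ?L (?E, ?\<phi>)"
    by (rule L.finite_gsetI)
       (use closed E gset_one[OF S] gset_mult[OF S] LG finite_fixed_points[OF S] in auto)
  then interpret act: group_action ?L ?E ?\<phi>
    by (simp add: finite_gset_def)
  have "card (orbits ?L ?E ?\<phi>) * card L = (\<Sum>g\<in>L. card (invariants ?E ?\<phi> g))"
    using act.burnside finite_fixed_points[OF S] finite_subset[OF subgroup.subset[OF L] fin]
    by (simp add: order_def)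
  moreover have "invariants ?E ?\<phi> g = fixed_points G S (insert g H)" if "g \<in> L" for g
    using LG[OF that] by (auto simp: invariants_def fixed_points_def)
  ultimately have "card (orbits ?L ?E ?\<phi>) * card L = (\<Sum>g\<in>L. card (fixed_points G S (insert g H)))"
    by simp
  then have "(\<Sum>g\<in>L. mark G S (insert g H)) = int (card (orbits ?L ?E ?\<phi>)) * int (card L)"
    unfolding mark_def by (metis of_nat_mult of_nat_sum)
  then show ?thesis
    by simp
qed

text \<open>Functions on subgroups that are constant on conjugacy classes and satisfy Burnside's congruences,
  extended to all sets through the subgroup that a set generates. In the congruence \<open>L\<close> is
  any subgroup that normalises \<open>H\<close>. The sum runs over \<open>L\<close> instead of the image of \<open>L\<close> in the
  quotient of the normaliser by \<open>H\<close>, which avoids quotient groups.\<close>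

definition ghost :: "('a set \<Rightarrow> int) set" where
  "ghost = {f. (\<forall>A. f (generate G (A \<inter> carrier G)) = f A)
     \<and> (\<forall>g\<in>carrier G. \<forall>H. subgroup H G \<longrightarrow> f ((\<lambda>h. g \<otimes> h \<otimes> inv g) ` H) = f H)
     \<and> (\<forall>H L. subgroup H G \<longrightarrow> subgroup L G \<longrightarrow> (\<forall>g\<in>L. \<forall>h\<in>H. inv g \<otimes> h \<otimes> g \<in> H) \<longrightarrow>
          int (card L) dvd (\<Sum>g\<in>L. f (insert g H)))}"

lemma ghostI:
  assumes "\<And>A. f (generate G (A \<inter> carrier G)) = f A"
    and "\<And>g H. g \<in> carrier G \<Longrightarrow> subgroup H G \<Longrightarrow> f ((\<lambda>h. g \<otimes> h \<otimes> inv g) ` H) = f H"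
    and "\<And>H L. subgroup H G \<Longrightarrow> subgroup L G \<Longrightarrow>
      (\<And>g h. g \<in> L \<Longrightarrow> h \<in> H \<Longrightarrow> inv g \<otimes> h \<otimes> g \<in> H) \<Longrightarrow>
      int (card L) dvd (\<Sum>g\<in>L. f (insert g H))"
  shows "f \<in> ghost"
  unfolding ghost_def mem_Collect_eq using assms by (intro conjI allI ballI impI) simp_all

lemma ghostD:
  assumes "f \<in> ghost"
  shows ghost_generate: "f (generate G (A \<inter> carrier G)) = f A"
    and ghost_conjugate: "g \<in> carrier G \<Longrightarrow> subgroup H G \<Longrightarrow> f ((\<lambda>h. g \<otimes> h \<otimes> inv g) ` H) = f H"
    and ghost_congruence: "subgroup H G \<Longrightarrow> subgroup L G \<Longrightarrow>
      (\<And>g h. g \<in> L \<Longrightarrow> h \<in> H \<Longrightarrow> inv g \<otimes> h \<otimes> g \<in> H) \<Longrightarrow>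
      int (card L) dvd (\<Sum>g\<in>L. f (insert g H))"
  using assms unfolding ghost_def by simp_all

lemma mark_in_ghost: "finite_gset G S \<Longrightarrow> mark G S \<in> ghost"
  by (rule ghostI)
     (simp_all add: mark_generate mark_conjugate mark_congruence subgroup.subset)

lemma ghost_diff:
  assumes u: "u \<in> ghost" and v: "v \<in> ghost"
  shows "u - v \<in> ghost"
proof (rule ghostI)
  show "int (card L) dvd (\<Sum>g\<in>L. (u - v) (insert g H))"
    if "subgroup H G" "subgroup L G" "\<And>g h. g \<in> L \<Longrightarrow> h \<in> H \<Longrightarrow> inv g \<otimes> h \<otimes> g \<in> H" for H L
    using ghost_congruence[OF u that] ghost_congruence[OF v that] by (simp add: sum_subtractf)
qed (simp_all add: ghost_generate[OF u] ghost_generate[OF v] ghost_conjugate[OF u] ghost_conjugate[OF v])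

lemma differences_subset_ghost: "burnside.differences \<subseteq> ghost"
  by (auto elim!: ghostE intro!: ghost_diff mark_in_ghost)

lemma differences_scale:
  assumes v: "v \<in> burnside.differences"
  shows "(\<lambda>A. n * v A) \<in> burnside.differences"
proof -
  have nat: "(\<lambda>A. int m * v A) \<in> burnside.differences" for m
  proof (induction m)
    case 0
    then show ?case
      using burnside.zero_in_differences by (simp add: zero_fun_def)
  next
    case (Suc m)
    have "(\<lambda>A. int (Suc m) * v A) = v + (\<lambda>A. int m * v A)"
      by (simp add: fun_eq_iff algebra_simps)
    then show ?case
      using burnside.differences_add[OF v Suc] by simp
  qed
  show ?thesis
  proof (cases n)
    case (nonneg m)
    then show ?thesis
      using nat by simp
  next
    case (neg m)
    have "(\<lambda>A. n * v A) = - (\<lambda>A. int (Suc m) * v A)"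
      unfolding neg by (simp only: fun_eq_iff uminus_apply minus_mult_left) simp
    then show ?thesis
      using burnside.differences_uminus[OF nat[of "Suc m"]] by (simp only:)
  qed
qed

lemma lcosets_action:
  assumes H: "subgroup H G" and g: "g \<in> carrier G" and C: "C \<in> lcosets H"
  shows "g <# C \<in> lcosets H"
proof -
  obtain a where "a \<in> carrier G" "C = a <# H"
    using C by (auto simp: LCOSETS_def)
  then have "g <# C = (g \<otimes> a) <# H"
    using g subgroup.subset[OF H] by (simp add: lcos_m_assoc)
  then show ?thesis
    using g \<open>a \<in> carrier G\<close> by (auto simp: LCOSETS_def)
qed

lemma finite_coset_gset:
  assumes H: "subgroup H G"
  shows "finite_gset G (coset_gset G H)"
  unfolding coset_gset_def
proof (rule finite_gsetI)
  show "finite (lcosets H)"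
    using fin by (simp add: LCOSETS_def)
  fix C assume C: "C \<in> lcosets H"
  then have CG: "C \<subseteq> carrier G"
    using subgroup.lcosets_carrier[OF H is_group] by blast
  then show "\<one> <# C = C"
    by (rule lcos_mult_one)
  show "g <# C \<in> lcosets H" if "g \<in> carrier G" for g
    by (rule lcosets_action[OF H that C])
  show "(g \<otimes> h) <# C = g <# (h <# C)" if "g \<in> carrier G" "h \<in> carrier G" for g h
    using lcos_m_assoc[OF CG that] by simp
qed

text \<open>The coset \<open>a H\<close> is fixed by \<open>g\<close> exactly if \<open>a\<inverse> g a \<in> H\<close>. Counting the elements \<open>a\<close> instead of the
  cosets produces the factor \<open>\<bar>H\<bar>\<close> and avoids a division.\<close>

lemma mark_coset_gset:
  assumes H: "subgroup H G"
  shows "int (card H) * mark G (coset_gset G H) A =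
    int (card {a \<in> carrier G. \<forall>g\<in>A \<inter> carrier G. inv a \<otimes> g \<otimes> a \<in> H})"
proof -
  let ?F = "fixed_points G (coset_gset G H) A"
  have F: "?F \<subseteq> lcosets H"
    by (auto simp: fixed_points_def coset_gset_def)
  note HG = subgroup.subset[OF H]
  have fixed: "g <# (a <# H) = a <# H \<longleftrightarrow> inv a \<otimes> g \<otimes> a \<in> H"
    if a: "a \<in> carrier G" and g: "g \<in> carrier G" for a g
  proof -
    have "g <# (a <# H) = a <# H \<longleftrightarrow> (g \<otimes> a) <# H = a <# H"
      using lcos_m_assoc[OF HG g a] by simp
    also have "\<dots> \<longleftrightarrow> g \<otimes> a \<in> a <# H"
      using a g H l_repr_independence lcos_self m_closed by metis
    also have "\<dots> \<longleftrightarrow> inv a \<otimes> (g \<otimes> a) \<in> H"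
      using subgroup.lcos_module_imp[OF H is_group a] subgroup.lcos_module_rev[OF H is_group a] a g
      by blast
    finally show ?thesis
      using a g by (simp add: m_assoc)
  qed
  have "\<Union>?F = {a \<in> carrier G. \<forall>g\<in>A \<inter> carrier G. inv a \<otimes> g \<otimes> a \<in> H}"
  proof (intro equalityI subsetI)
    fix a assume "a \<in> \<Union>?F"
    then obtain C where C: "C \<in> ?F" "a \<in> C"
      by blast
    then have "a \<in> carrier G"
      using F subgroup.lcosets_carrier[OF H is_group] by blast
    moreover have "C = a <# H"
    proof -
      obtain b where "b \<in> carrier G" "C = b <# H"
        using C F by (auto simp: LCOSETS_def)
      then show ?thesis
        using C(2) H l_repr_independence by metis
    qed
    ultimately show "a \<in> {a \<in> carrier G. \<forall>g\<in>A \<inter> carrier G. inv a \<otimes> g \<otimes> a \<in> H}"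
      using C(1) fixed by (auto simp: fixed_points_def coset_gset_def)
  next
    fix a assume a: "a \<in> {a \<in> carrier G. \<forall>g\<in>A \<inter> carrier G. inv a \<otimes> g \<otimes> a \<in> H}"
    then have "a <# H \<in> lcosets H"
      by (auto simp: LCOSETS_def)
    then have "a <# H \<in> ?F"
      using a fixed by (auto simp: fixed_points_def coset_gset_def)
    then show "a \<in> \<Union>?F"
      using lcos_self[OF _ H] a by blast
  qed
  moreover have "card H * card ?F = card (\<Union>?F)"
  proof (rule card_partition)
    show "finite ?F"
      by (rule finite_fixed_points[OF finite_coset_gset[OF H]])
    have "\<Union>?F \<subseteq> carrier G"
      using F subgroup.lcosets_carrier[OF H is_group] by blast
    then show "finite (\<Union>?F)"
      using fin finite_subset by blast
    show "card C = card H" if "C \<in> ?F" for C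
      using l_card_cosets_equal[OF _ HG fin] F that by (metis subsetD)
    show "C \<inter> D = {}" if "C \<in> ?F" "D \<in> ?F" "C \<noteq> D" for C D
      using lcos_disjoint[OF H] F that by blast
  qed
  ultimately show ?thesis
    unfolding mark_def by (metis of_nat_mult)
qed

lemma subgroup_conjugate:
  assumes "subgroup H G" "g \<in> carrier G"
  shows "subgroup ((\<lambda>h. g \<otimes> h \<otimes> inv g) ` H) G"
proof -
  have "g <# H #> inv g = (\<lambda>h. g \<otimes> h \<otimes> inv g) ` H"
    by (auto simp: l_coset_def r_coset_def)
  then show ?thesis
    using subgroup_conjugation_is_surj2[OF assms(2,1)] by simp
qed

lemma card_conjugate:
  assumes "H \<subseteq> carrier G" "g \<in> carrier G"
  shows "card ((\<lambda>h. g \<otimes> h \<otimes> inv g) ` H) = card H"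
  using conjugation_is_inj[OF assms(2)] assms(1) by (intro card_image inj_onI) blast

text \<open>The normaliser of \<open>H\<close>. For a finite \<open>H\<close> the inclusion \<open>g\<inverse> H g \<subseteq> H\<close> is an equality, because
  conjugation is injective. The one-sided condition is the one in the congruences, and at \<open>A = H\<close>
  it is the one in \<open>mark_coset_gset\<close>.\<close>

definition Norm :: "'a set \<Rightarrow> 'a set" where
  "Norm H = {g \<in> carrier G. \<forall>h\<in>H. inv g \<otimes> h \<otimes> g \<in> H}"

lemma subgroup_Norm:
  assumes H: "subgroup H G"
  shows "subgroup (Norm H) G"
proof -
  note HG = subgroup.mem_carrier[OF H]
  have mult: "g \<otimes> k \<in> Norm H" if "g \<in> Norm H" "k \<in> Norm H" for g k
  proof -
    have "inv (g \<otimes> k) \<otimes> h \<otimes> (g \<otimes> k) = inv k \<otimes> (inv g \<otimes> h \<otimes> g) \<otimes> k" if "h \<in> H" for h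
      using \<open>g \<in> Norm H\<close> \<open>k \<in> Norm H\<close> HG[OF that] by (simp add: Norm_def m_assoc inv_mult_group)
    then show ?thesis
      using that by (auto simp: Norm_def)
  qed
  have sub: "Norm H \<subseteq> carrier G"
    by (auto simp: Norm_def)
  show ?thesis
  proof (rule subgroupI[OF sub])
    have "\<one> \<in> Norm H"
      using HG by (simp add: Norm_def)
    then show "Norm H \<noteq> {}"
      by blast
    show "inv g \<in> Norm H" if g: "g \<in> Norm H" for g
    proof -
      have gG: "g \<in> carrier G"
        using g by (simp add: Norm_def)
      have "inj_on (\<lambda>h. inv g \<otimes> h \<otimes> g) H"
        using gG HG by (auto simp: inj_on_def)
      moreover have "(\<lambda>h. inv g \<otimes> h \<otimes> g) ` H \<subseteq> H"
        using g by (auto simp: Norm_def)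
      ultimately have surj: "(\<lambda>h. inv g \<otimes> h \<otimes> g) ` H = H"
        using endo_inj_surj[OF finite_subset[OF subgroup.subset[OF H] fin]] by blast
      have "g \<otimes> h \<otimes> inv g \<in> H" if h: "h \<in> H" for h
      proof -
        obtain k where k: "k \<in> H" "h = inv g \<otimes> k \<otimes> g"
          using surj h by blast
        then have "g \<otimes> h \<otimes> inv g = k"
          using conjugation_is_surj[OF gG HG[OF k(1)]] by simp
        then show ?thesis
          using k by simp
      qed
      then show ?thesis
        using gG by (simp add: Norm_def)
    qed
  qed (rule mult)
qed

lemma subgroup_subset_Norm:
  assumes H: "subgroup H G" shows "H \<subseteq> Norm H"
  unfolding Norm_def
  using subgroup.mem_carrier[OF H] subgroup.m_closed[OF H] subgroup.m_inv_closed[OF H] by auto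

text \<open>Marks satisfy the congruences. For the converse, let \<open>f\<close> satisfy them and vanish outside a family
  \<open>\<F>\<close> of subgroups that is closed under subgroups and conjugation. Let \<open>H\<close> be a largest member. In the
  congruence for \<open>H\<close> and its normaliser \<open>N\<close> all terms with \<open>g \<notin> H\<close> vanish, so \<open>\<bar>N\<bar>\<close> divides \<open>\<bar>H\<bar> f H\<close>.
  As \<open>\<bar>N\<bar> / \<bar>H\<bar>\<close> is the mark of \<open>G/H\<close> at \<open>H\<close>, an integral multiple of the mark function of \<open>G/H\<close> agrees
  with \<open>f\<close> at \<open>H\<close>. Subtracting it removes the conjugates of \<open>H\<close> from the family; it does not enlarge
  the family, since \<open>G/H\<close> only has marks at subgroups of conjugates of \<open>H\<close>.\<close>

theorem differences_eq_ghost: "burnside.differences = ghost"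
proof
  show "burnside.differences \<subseteq> ghost"
    by (rule differences_subset_ghost)
  have supported: "f \<in> burnside.differences"
    if "finite \<F>" "f \<in> ghost" "\<F> \<subseteq> {H. subgroup H G}"
      and "\<And>H K. H \<in> \<F> \<Longrightarrow> subgroup K G \<Longrightarrow> K \<subseteq> H \<Longrightarrow> K \<in> \<F>"
      and "\<And>H g. H \<in> \<F> \<Longrightarrow> g \<in> carrier G \<Longrightarrow> (\<lambda>h. g \<otimes> h \<otimes> inv g) ` H \<in> \<F>"
      and "\<And>H. subgroup H G \<Longrightarrow> H \<notin> \<F> \<Longrightarrow> f H = 0"
    for f \<F>
    using that
  proof (induction "card \<F>" arbitrary: f \<F> rule: less_induct)
    case less
    note subgroups = less.prems(3) and down = less.prems(4) and conj = less.prems(5)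
      and vanish = less.prems(6)
    have gen: "f A = f (generate G (A \<inter> carrier G))" for A
      by (rule ghost_generate[OF less.prems(2), symmetric])
    show ?case
    proof (cases "\<F> = {}")
      case True
      have "f A = 0" for A
        using gen[of A] vanish[OF generate_is_subgroup[of "A \<inter> carrier G"]] True by simp
      then have "f = 0"
        by (simp add: fun_eq_iff)
      then show ?thesis
        using burnside.zero_in_differences by simp
    next
      case False
      have "Max (card ` \<F>) \<in> card ` \<F>"
        using less.prems(1) False by (intro Max_in) auto
      then obtain H where H: "H \<in> \<F>" and "card H = Max (card ` \<F>)"
        by auto
      then have max: "card K \<le> card H" if "K \<in> \<F>" for K
        using Max_ge[of "card ` \<F>" "card K"] less.prems(1) that by simp
      have HS: "subgroup H G"
        using H subgroups by blast
      note HG = subgroup.subset[OF HS]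
      have finH: "finite H"
        using HG fin finite_subset by blast
      \<comment> \<open>\<open>\<langle>g, H\<rangle>\<close> is larger than the largest member of \<open>\<F>\<close>.\<close>
      have outside: "f (insert g H) = 0" if g: "g \<in> Norm H - H" for g
      proof -
        have gG: "insert g H \<subseteq> carrier G"
          using g HG by (auto simp: Norm_def)
        let ?K = "generate G (insert g H)"
        have K: "subgroup ?K G" "insert g H \<subseteq> ?K"
          using generate_is_subgroup[OF gG] generate.incl[of _ "insert g H" G] by auto
        have "card (insert g H) \<le> card ?K"
          using K finite_subset[OF subgroup.subset[OF K(1)] fin] card_mono by blast
        then have "?K \<notin> \<F>"
          using max[of ?K] g finH by auto
        then show ?thesis
          using vanish[OF K(1)] gen[of "insert g H"] gG by (simp add: Int_absorb2)
      qed
      have "int (card (Norm H)) dvd (\<Sum>g\<in>Norm H. f (insert g H))"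
        by (rule ghost_congruence[OF less.prems(2) HS subgroup_Norm[OF HS]]) (simp add: Norm_def)
      also have "(\<Sum>g\<in>Norm H. f (insert g H)) = (\<Sum>g\<in>H. f (insert g H))"
        using finite_subset[OF subgroup.subset[OF subgroup_Norm[OF HS]] fin] subgroup_subset_Norm[OF HS]
          outside by (intro sum.mono_neutral_right) auto
      also have "\<dots> = int (card H) * f H"
        by (simp add: insert_absorb)
      finally obtain n where n: "int (card H) * f H = int (card (Norm H)) * n"
        by (auto simp: dvd_def)
      let ?m = "mark G (coset_gset G H)"
      have m: "?m \<in> burnside.differences"
        by (rule mark_in_differences[OF finite_coset_gset[OF HS]])
      have m_H: "int (card H) * ?m H = int (card (Norm H))"
        using mark_coset_gset[OF HS, of H] HG by (simp add: Norm_def Int_absorb2)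
      have cardH: "card H > 0"
        using finH subgroup.one_closed[OF HS] card_gt_0_iff by blast
      have "int (card H) * f H = int (card H) * (n * ?m H)"
        using n m_H by (metis mult.assoc mult.commute)
      then have f_H: "f H = n * ?m H"
        using cardH by simp
      let ?C = "{(\<lambda>h. g \<otimes> h \<otimes> inv g) ` H | g. g \<in> carrier G}"
      let ?f = "f - (\<lambda>A. n * ?m A)"
      have nm: "(\<lambda>A. n * ?m A) \<in> burnside.differences"
        by (rule differences_scale[OF m])
      have f': "?f \<in> ghost"
        by (rule ghost_diff[OF less.prems(2)]) (use nm differences_subset_ghost in blast)
      have "H \<in> ?C"
      proof -
        have "(\<lambda>h. \<one> \<otimes> h \<otimes> inv \<one>) ` H = H"
          using HG by force
        then show ?thesis
          by blast
      qed
      have m_nonzero: "\<exists>g\<in>carrier G. K \<subseteq> (\<lambda>h. g \<otimes> h \<otimes> inv g) ` H"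
        if K: "subgroup K G" and "?m K \<noteq> 0" for K
      proof -
        have "{a \<in> carrier G. \<forall>k\<in>K \<inter> carrier G. inv a \<otimes> k \<otimes> a \<in> H} \<noteq> {}"
        proof
          assume "{a \<in> carrier G. \<forall>k\<in>K \<inter> carrier G. inv a \<otimes> k \<otimes> a \<in> H} = {}"
          then have "int (card H) * ?m K = 0"
            using mark_coset_gset[OF HS, of K] by (simp only: card.empty of_nat_0)
          then show False
            using that cardH by simp
        qed
        then obtain a where a: "a \<in> carrier G" "\<And>k. k \<in> K \<Longrightarrow> inv a \<otimes> k \<otimes> a \<in> H"
          using subgroup.subset[OF K] by blast
        have "k = a \<otimes> (inv a \<otimes> k \<otimes> a) \<otimes> inv a" if "k \<in> K" for k
          using conjugation_is_surj[OF a(1) subgroup.mem_carrier[OF K that]] by simp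
        then show ?thesis
          using a by blast
      qed
      have "?f \<in> burnside.differences"
      proof (rule less.hyps[of "\<F> - ?C"])
        show "card (\<F> - ?C) < card \<F>"
          using less.prems(1) H \<open>H \<in> ?C\<close> by (intro psubset_card_mono) auto
        show "finite (\<F> - ?C)" "?f \<in> ghost" "\<F> - ?C \<subseteq> {H. subgroup H G}"
          using less.prems(1) f' subgroups by auto
        \<comment> \<open>A subgroup of \<open>K\<close> that is conjugate to \<open>H\<close> has maximal order in \<open>\<F>\<close>, so it is \<open>K\<close> itself.\<close>
        show "K' \<in> \<F> - ?C" if K: "K \<in> \<F> - ?C" "subgroup K' G" "K' \<subseteq> K" for K K'
        proof -
          have "K' \<in> \<F>"
            using K down by blast
          moreover have "K' \<notin> ?C"
          proof
            assume "K' \<in> ?C"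
            then have "card K' = card H"
              using card_conjugate[OF HG] by auto
            moreover have "subgroup K G"
              using K(1) subgroups by blast
            then have "finite K"
              using finite_subset[OF subgroup.subset fin] by blast
            ultimately have "K' = K"
              using K max[of K] by (intro card_seteq) auto
            then show False
              using \<open>K' \<in> ?C\<close> K(1) by blast
          qed
          ultimately show ?thesis
            by blast
        qed
        show "(\<lambda>h. g \<otimes> h \<otimes> inv g) ` K \<in> \<F> - ?C" if K: "K \<in> \<F> - ?C" and g: "g \<in> carrier G" for K g
        proof -
          have "subgroup K G"
            using K subgroups by blast
          then have KG: "K \<subseteq> carrier G"
            by (rule subgroup.subset)
          have "(\<lambda>h. g \<otimes> h \<otimes> inv g) ` K \<notin> ?C"
          proof
            assume "(\<lambda>h. g \<otimes> h \<otimes> inv g) ` K \<in> ?C"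
            then obtain a where a: "a \<in> carrier G"
              "(\<lambda>h. g \<otimes> h \<otimes> inv g) ` K = (\<lambda>h. a \<otimes> h \<otimes> inv a) ` H"
              by blast
            have "K = (\<lambda>h. inv g \<otimes> h \<otimes> g) ` (\<lambda>h. g \<otimes> h \<otimes> inv g) ` K"
            proof -
              have "inv g \<otimes> (g \<otimes> k \<otimes> inv g) \<otimes> g = k" if "k \<in> K" for k
                using conjugation_is_surj[of "inv g" k] g KG that by auto
              then show ?thesis
                by (simp add: image_image)
            qed
            also have "\<dots> = (\<lambda>h. (inv g \<otimes> a) \<otimes> h \<otimes> inv (inv g \<otimes> a)) ` H"
              unfolding a(2) image_image
              using HG g a(1) by (intro image_cong) (auto simp: m_assoc inv_mult_group)
            finally show False
              using K g a(1) by blast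
          qed
          then show ?thesis
            using K g conj by blast
        qed
        show "?f K = 0" if K: "subgroup K G" "K \<notin> \<F> - ?C" for K
        proof (cases "K \<in> ?C")
          case True
          then obtain g where g: "g \<in> carrier G" "K = (\<lambda>h. g \<otimes> h \<otimes> inv g) ` H"
            by blast
          then have "?f K = ?f H"
            using ghost_conjugate[OF f' g(1) HS] by simp
          then show ?thesis
            using f_H by simp
        next
          case False
          then have "K \<notin> \<F>"
            using K by blast
          then have "f K = 0"
            using vanish K by blast
          moreover have "?m K = 0"
          proof (rule ccontr)
            assume "?m K \<noteq> 0"
            then obtain g where "g \<in> carrier G" "K \<subseteq> (\<lambda>h. g \<otimes> h \<otimes> inv g) ` H"
              using m_nonzero[OF K(1)] by blast
            then show False
              using \<open>K \<notin> \<F>\<close> H down conj K(1) by blast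
          qed
          ultimately show ?thesis
            by simp
        qed
      qed
      then have "?f + (\<lambda>A. n * ?m A) \<in> burnside.differences"
        using nm by (rule burnside.differences_add)
      then show ?thesis
        by simp
    qed
  qed
  show "ghost \<subseteq> burnside.differences"
  proof
    fix f assume f: "f \<in> ghost"
    show "f \<in> burnside.differences"
    proof (rule supported[of "{H. subgroup H G}", OF _ f])
      show "finite {H. subgroup H G}"
        using finite_subset[of "{H. subgroup H G}" "Pow (carrier G)"] fin subgroup.subset by auto
    qed (use subgroup_conjugate in auto)
  qed
qed

end

section \<open>Units are constant along prime-index steps\<close>

context finite_group
begin

lemma card_subgroup_dvd:
  assumes N: "subgroup N G" and L: "subgroup L G" and "N \<subseteq> L"
  shows "card N dvd card L"
proof -
  interpret L: group "G\<lparr>carrier := L\<rparr>"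
    by (rule subgroup_imp_group[OF L])
  have "subgroup N (G\<lparr>carrier := L\<rparr>)"
    by (rule subgroup_incl[OF assms])
  from L.lagrange[OF this] show ?thesis
    by (simp add: order_def) (metis dvd_triv_right)
qed

lemma finite_subgroup: "subgroup H G \<Longrightarrow> finite H"
  using fin subgroup.subset finite_subset by blast

lemma card_subgroup_pos: "subgroup H G \<Longrightarrow> card H > 0"
  using finite_subgroup subgroup.one_closed card_gt_0_iff by blast

text \<open>For \<open>g \<in> N\<close> the set \<open>\<langle>g, N\<rangle>\<close> is \<open>N\<close>, for all other \<open>g \<in> L\<close> it is \<open>L\<close>, as there is no subgroup in
  between. So the congruence sum is \<open>\<bar>N\<bar> (f N + (p - 1) f L)\<close>, and it is divisible by \<open>\<bar>L\<bar> = p \<bar>N\<bar>\<close>.\<close>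

lemma prime_index_congruence:
  assumes f: "f \<in> ghost" and N: "subgroup N G" and L: "subgroup L G" and NL: "N \<subseteq> L"
    and normal: "\<And>g h. g \<in> L \<Longrightarrow> h \<in> N \<Longrightarrow> inv g \<otimes> h \<otimes> g \<in> N"
    and p: "prime p" and index: "card L = p * card N"
  shows "int p dvd f N - f L"
proof -
  have gen: "generate G (insert g N) = L" if g: "g \<in> L - N" for g
  proof -
    let ?K = "generate G (insert g N)"
    have gN: "insert g N \<subseteq> carrier G"
      using g subgroup.subset[OF L] subgroup.subset[OF N] by blast
    have K: "subgroup ?K G"
      by (rule generate_is_subgroup[OF gN])
    have sub: "insert g N \<subseteq> ?K"
      using generate.incl[of _ "insert g N" G] by blast
    have KL: "?K \<subseteq> L"
      using generate_subgroup_incl[OF _ L] g NL by blast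
    obtain m where m: "card ?K = card N * m"
      using card_subgroup_dvd[OF N K] sub by (auto simp: dvd_def)
    have "p * card N dvd card N * p" "card N * m dvd card N * p"
      using card_subgroup_dvd[OF K L KL] m index by (simp_all add: mult.commute)
    then have "m dvd p"
      using card_subgroup_pos[OF N] by simp
    moreover have "card (insert g N) \<le> card ?K"
      using card_mono[OF finite_subgroup[OF K] sub] .
    then have "m \<noteq> 1"
      using m g finite_subgroup[OF N] by auto
    ultimately have "m = p"
      using p unfolding prime_nat_iff by blast
    then show ?thesis
      using KL m index card_subset_eq[OF finite_subgroup[OF L] KL] by (simp add: mult.commute)
  qed
  have f_gen: "f (insert g N) = f L" if g: "g \<in> L - N" for g
  proof -
    have "insert g N \<inter> carrier G = insert g N"
      using g subgroup.subset[OF L] subgroup.subset[OF N] by blast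
    then show ?thesis
      using ghost_generate[OF f, of "insert g N"] gen[OF g] by simp
  qed
  have "(\<Sum>g\<in>L. f (insert g N)) = (\<Sum>g\<in>L - N. f (insert g N)) + (\<Sum>g\<in>N. f (insert g N))"
    by (rule sum.subset_diff[OF NL finite_subgroup[OF L]])
  also have "\<dots> = int (card (L - N)) * f L + int (card N) * f N"
    by (simp add: f_gen insert_absorb)
  also have "int (card (L - N)) = int (card L) - int (card N)"
    using card_Diff_subset[OF finite_subgroup[OF N] NL] card_mono[OF finite_subgroup[OF L] NL] by simp
  finally have "(\<Sum>g\<in>L. f (insert g N)) = int (card N) * (f N - f L + int p * f L)"
    using index by (simp add: algebra_simps)
  moreover have "int (card L) dvd (\<Sum>g\<in>L. f (insert g N))"
    by (rule ghost_congruence[OF f N L normal])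
  ultimately have "int (card N) * int p dvd int (card N) * (f N - f L + int p * f L)"
    using index by (simp add: mult.commute)
  then have "int p dvd f N - f L + int p * f L"
    using card_subgroup_pos[OF N] by simp
  then show ?thesis
    by (metis dvd_add_left_iff dvd_triv_left)
qed

text \<open>Descending along normal subgroups of prime index, \<open>f\<close> never changes: each step changes its value
  by \<open>0\<close> or \<open>\<plusminus>2\<close> and by a multiple of an odd prime.\<close>

lemma sign_valued_ghost_const:
  assumes f: "f \<in> ghost" and sign: "\<And>A. f A = 1 \<or> f A = - 1" and odd: "odd (order G)"
    and chain: "\<And>H. subgroup H G \<Longrightarrow> H \<noteq> {\<one>} \<Longrightarrow> \<exists>N p. subgroup N G \<and> N \<subseteq> H \<and>
      (\<forall>g\<in>H. \<forall>h\<in>N. inv g \<otimes> h \<otimes> g \<in> N) \<and> prime p \<and> card H = p * card N"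
  shows "f = 1 \<or> f = - 1"
proof -
  have const: "f H = f {\<one>}" if "subgroup H G" for H
    using that
  proof (induction "card H" arbitrary: H rule: less_induct)
    case less
    show ?case
    proof (cases "H = {\<one>}")
      case False
      then obtain N p where N: "subgroup N G" "N \<subseteq> H" "\<forall>g\<in>H. \<forall>h\<in>N. inv g \<otimes> h \<otimes> g \<in> N"
        and p: "prime p" "card H = p * card N"
        using chain[OF less.prems] by blast
      have "p dvd order G"
        using card_subgroup_dvd[OF less.prems subgroup_self] subgroup.subset[OF less.prems] p(2)
        by (metis dvd_mult_left order_def)
      then have "odd p"
        using odd dvd_trans by blast
      then have "p > 2"
        using prime_gt_1_nat[OF p(1)] by (cases "p = 2") auto
      have "int p dvd f N - f H"
        using prime_index_congruence[OF f N(1) less.prems N(2)] N(3) p by blast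
      moreover have "\<bar>f N - f H\<bar> < int p"
        using sign[of N] sign[of H] \<open>p > 2\<close> by auto
      ultimately have "f N = f H"
        using dvd_imp_le_int[of "f N - f H" "int p"] by fastforce
      moreover have "card N < card H"
        using p card_subgroup_pos[OF N(1)] prime_gt_1_nat[OF p(1)] by simp
      ultimately show ?thesis
        using less.hyps[OF _ N(1)] by simp
    qed simp
  qed
  have "f A = f {\<one>}" for A
    using const[OF generate_is_subgroup[of "A \<inter> carrier G"]] ghost_generate[OF f, of A] by simp
  then have "f = (\<lambda>A. f {\<one>})"
    by (simp add: fun_eq_iff)
  then show ?thesis
    using sign[of "{\<one>}"] by (auto simp: fun_eq_iff)
qed

end

section \<open>Quotients of prime order\<close>

lemma order_eq_kernel:
  assumes "group_hom G P \<phi>" "finite (carrier G)" "\<phi> ` carrier G = carrier P"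
  shows "order G = order P * card (kernel G P \<phi>)"
proof -
  interpret group_hom G P \<phi> by fact
  have "card (carrier (G Mod kernel G P \<phi>)) = order P"
    using FactGroup_iso_set[OF assms(3)] unfolding iso_def order_def
    by (auto dest: bij_betw_same_card)
  moreover have "card (rcosets\<^bsub>G\<^esub> kernel G P \<phi>) * card (kernel G P \<phi>) = order G"
    by (rule G.lagrange[OF subgroup_kernel])
  ultimately show ?thesis
    by (simp add: FactGroup_def)
qed

text \<open>By Sylow's theorem there is a subgroup of prime order; it is normal, hence everything.\<close>

lemma comm_simple_group_prime_order:
  assumes simple: "simple_group G" and comm: "comm_group G" and fin: "finite (carrier G)"
  shows "prime (order G)"
proof -
  interpret simple_group G by fact
  obtain p where p: "prime p" "p dvd order G"
    using prime_factor_nat order_gt_one by (metis less_irrefl)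
  then obtain m where "order G = p ^ 1 * m"
    by (auto simp: dvd_def)
  then obtain H where H: "subgroup H G" "card H = p"
    using sylow_thm[OF p(1) is_group _ fin] by (metis power_one_right)
  then have "H \<lhd> G"
    using comm_group.subgroup_imp_normal[OF comm] by blast
  then have "H = carrier G"
    using no_real_normal_subgroup[of H] H(2) p(1) by auto
  then show ?thesis
    using H(2) p(1) by (simp add: order_def)
qed

text \<open>A copy of \<open>G / M\<close> on the type of \<open>G\<close>: each element is sent to a chosen representative of its
  coset. The hypothesis that simple groups of odd order are abelian speaks of groups on one fixed
  type, so quotients of \<open>G\<close> must live on that type before it can be applied to them.\<close>

lemma (in group) quotient_on_representatives:
  assumes M: "M \<lhd> G"
  shows "\<exists>f :: 'a \<Rightarrow> 'a. weak_group_morphism f M G"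
proof -
  interpret M: normal M G by fact
  define f where "f a = (SOME x. x \<in> M #> a)" for a
  have f: "f a \<in> M #> a" if "a \<in> carrier G" for a
    unfolding f_def using rcos_self[OF that M.subgroup_axioms] by (rule someI)
  have "f a = f b \<longleftrightarrow> a \<otimes> inv b \<in> M" if a: "a \<in> carrier G" and b: "b \<in> carrier G" for a b
  proof
    assume "f a = f b"
    then have "M #> a = M #> b"
      using f[OF a] f[OF b] repr_independence[OF _ _ M.subgroup_axioms] a b by metis
    then have "a \<in> M #> b"
      using rcos_self[OF a M.subgroup_axioms] by simp
    then show "a \<otimes> inv b \<in> M"
      using M.rcos_module_imp[OF is_group b] by blast
  next
    assume "a \<otimes> inv b \<in> M"
    then have "a \<in> M #> b"
      using M.rcos_module_rev[OF is_group b a] by blast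
    then have "M #> b = M #> a"
      by (rule repr_independence[OF _ b M.subgroup_axioms])
    then show "f a = f b"
      by (simp add: f_def)
  qed
  then have "weak_group_morphism f M G"
    by (rule weak_group_morphismsI[OF M])
  then show ?thesis
    by blast
qed

text \<open>Unless \<open>G\<close> is simple, pass to the quotient by a proper non-trivial normal subgroup, which again has
  odd order. The process ends with a simple group, which is abelian and thus of prime order.
  Working with surjective homomorphisms instead of normal subgroups makes the steps compose.\<close>

lemma prime_order_quotient_exists:
  fixes G :: "'a monoid"
  assumes simple_comm: "\<And>Q :: 'a monoid. group Q \<Longrightarrow> finite (carrier Q) \<Longrightarrow> odd (order Q) \<Longrightarrow>
      simple_group Q \<Longrightarrow> comm_group Q"
    and "group G" "finite (carrier G)" "odd (order G)" "order G > 1"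
  shows "\<exists>(P :: 'a monoid) \<phi>. group P \<and> prime (order P) \<and> \<phi> \<in> hom G P \<and> \<phi> ` carrier G = carrier P"
  using assms(2-)
proof (induction "order G" arbitrary: G rule: less_induct)
  case less
  note fin = \<open>finite (carrier G)\<close>
  interpret group G by fact
  show ?case
  proof (cases "simple_group G")
    case True
    then have "prime (order G)"
      using comm_simple_group_prime_order simple_comm less.prems by blast
    then show ?thesis
      using is_group by (intro exI[of _ G] exI[of _ "\<lambda>x. x"]) (simp add: hom_def)
  next
    case False
    then obtain M where M: "M \<lhd> G" "M \<noteq> carrier G" "M \<noteq> {\<one>\<^bsub>G\<^esub>}"
      using less.prems(4) is_group unfolding simple_group_def simple_group_axioms_def by blast
    obtain f :: "'a \<Rightarrow> 'a" where f: "weak_group_morphism f M G"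
      using quotient_on_representatives[OF M(1)] by blast
    let ?Q = "image_group f G"
    have hom: "group_hom G ?Q f"
      by (rule weak_group_morphism_group_hom[OF f])
    have Q: "group ?Q" "f ` carrier G = carrier ?Q"
      using image_group_is_group[OF f] by (simp_all add: image_group_carrier)
    have order: "order G = order ?Q * card M"
      using order_eq_kernel[OF hom fin] Q(2) weak_group_morphism_ker[OF f] by simp
    have MG: "subgroup M G"
      using M(1) by (simp add: normal_def)
    have "card M \<noteq> 1"
      using M(3) subgroup.one_closed[OF MG] by (auto simp: card_1_singleton_iff)
    moreover have "card M \<noteq> order G"
      using card_subset_eq[OF fin subgroup.subset[OF MG]] M(2) by (auto simp: order_def)
    moreover have "card M \<noteq> 0" "order ?Q \<noteq> 0"
      using order less.prems(4) by (intro notI; simp)+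
    ultimately have "card M > 1" "order ?Q > 1"
      using order by (simp_all add: nat_neq_iff)
    then have "order ?Q < order G"
      using order by simp
    moreover have "finite (carrier ?Q)"
      using Q(2) fin by (metis finite_imageI)
    moreover have "odd (order ?Q)"
      using order less.prems(3) by auto
    ultimately obtain P :: "'a monoid" and \<phi> where P: "group P" "prime (order P)" "\<phi> \<in> hom ?Q P"
      "\<phi> ` carrier ?Q = carrier P"
      using less.hyps[of ?Q] Q(1) \<open>order ?Q > 1\<close> by blast
    have "\<phi> \<circ> f \<in> hom G P"
      using Group.hom_compose[OF group_hom.homh[OF hom] P(3)] .
    moreover have "(\<phi> \<circ> f) ` carrier G = carrier P"
      using Q(2) P(4) by (metis image_comp)
    ultimately show ?thesis
      using P by blast
  qed
qed

lemma (in finite_group) prime_index_subgroup: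
  assumes H: "subgroup H G" and P: "group P" "prime (order P)"
    and \<phi>: "\<phi> \<in> hom (G\<lparr>carrier := H\<rparr>) P" "\<phi> ` H = carrier P"
  shows "\<exists>N p. subgroup N G \<and> N \<subseteq> H \<and>
      (\<forall>g\<in>H. \<forall>h\<in>N. inv g \<otimes> h \<otimes> g \<in> N) \<and> prime p \<and> card H = p * card N"
proof -
  let ?H = "G\<lparr>carrier := H\<rparr>"
  let ?N = "kernel ?H P \<phi>"
  have hom: "group_hom ?H P \<phi>"
    using \<phi> P subgroup_imp_group[OF H] by (simp add: group_hom_def group_hom_axioms_def)
  interpret hom: group_hom ?H P \<phi>
    by (rule hom)
  have N: "subgroup ?N G"
    using incl_subgroup[OF H hom.subgroup_kernel] .
  have "?N \<subseteq> H"
    by (auto simp: kernel_def)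
  moreover have "inv g \<otimes> h \<otimes> g \<in> ?N" if g: "g \<in> H" and h: "h \<in> ?N" for g h
    using normal.inv_op_closed1[OF hom.normal_kernel, of g h] g h m_inv_consistent[OF H g] by simp
  moreover have "card H = order P * card ?N"
    using order_eq_kernel[OF hom] \<phi>(2) finite_subgroup[OF H] by (simp add: order_def)
  ultimately show ?thesis
    using N P(2) by blast
qed

section \<open>Units of Burnside rings\<close>

context finite_group
begin

abbreviation "cl \<equiv> burnside.diff_class"

lemma unit_marks:
  assumes "v * w = (1 :: 'a set \<Rightarrow> int)"
  shows "v A = 1 \<or> v A = - 1"
  using fun_cong[OF assms, of A] zmult_eq_1_iff[of "v A" "w A"] by auto

lemma cl_one_neq: "cl 1 \<noteq> cl (- 1)"
proof
  assume "cl 1 = cl (- 1)"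
  then have "(1 :: 'a set \<Rightarrow> int) = - 1"
    using inj_onD[OF burnside.inj_diff_class] burnside.one_in_differences burnside.differences_uminus
    by blast
  then show False
    by (simp add: fun_eq_iff)
qed

lemma cl_pm_one_Units: "{cl 1, cl (- 1)} \<subseteq> Units (burnside_ring G)"
  unfolding burnside_ring_def
  using burnside.diff_class_in_Units[of 1 1] burnside.diff_class_in_Units[of "- 1" "- 1"]
    burnside.one_in_differences burnside.differences_uminus by auto

lemma mark_coset_carrier: "mark G (coset_gset G (carrier G)) = 1"
proof
  fix A
  have "{a \<in> carrier G. \<forall>g\<in>A \<inter> carrier G. inv a \<otimes> g \<otimes> a \<in> carrier G} = carrier G"
    by auto
  then show "mark G (coset_gset G (carrier G)) A = 1 A"
    using mark_coset_gset[OF subgroup_self, of A] card_subgroup_pos[OF subgroup_self] by simp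
qed

lemma burnside_basis_eq:
  assumes "subgroup H G"
  shows "burnside_basis G H = cl (mark G (coset_gset G H))"
  unfolding burnside_basis_def
  using finite_coset_gset[OF assms] by (simp add: burnside.embed_eq gset_class_in_carrier class_mark)

lemma burnside_basis_image:
  assumes "\<And>H. H \<in> \<D> \<Longrightarrow> subgroup H G"
  shows "burnside_basis G ` \<D> = cl ` (\<lambda>H. mark G (coset_gset G H)) ` \<D>"
  using burnside_basis_eq assms by (simp add: image_image)

lemma Units_partial_subset:
  assumes sub: "\<And>H. H \<in> \<D> \<Longrightarrow> subgroup H G"
  shows "Units (partial_burnside_ring G \<D>) \<subseteq> Units (burnside_ring G)"
proof -
  have basis: "burnside_basis G ` \<D> = cl ` (\<lambda>H. mark G (coset_gset G H)) ` \<D>"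
    by (rule burnside_basis_image[OF sub])
  have "generate (add_monoid (burnside_ring G)) (burnside_basis G ` \<D>) \<subseteq> carrier (burnside_ring G)"
    unfolding burnside_ring_def basis
    using mark_in_differences[OF finite_coset_gset[OF sub]]
    by (intro burnside.generate_subset_carrier) blast
  then show ?thesis
    by (auto simp: Units_def partial_burnside_ring_def)
qed

text \<open>If \<open>1\<close> and \<open>- 1\<close> are the only units, then a partial Burnside ring loses none of them, since
  \<open>[G/G] = 1\<close> is among its generators. The two unit groups are then equal, not just isomorphic.\<close>

lemma Units_partial_eq:
  assumes units: "order (units_of (burnside_ring G)) = 2" and D: "carrier G \<in> \<D>"
    and sub: "\<And>H. H \<in> \<D> \<Longrightarrow> subgroup H G"
  shows "units_of (partial_burnside_ring G \<D>) = units_of (burnside_ring G)"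
proof -
  let ?B = "burnside_ring G" and ?P = "partial_burnside_ring G \<D>"
  have "card (Units ?B) = 2"
    using units by (simp add: order_def units_of_def)
  moreover have "finite (Units ?B)"
    using \<open>card (Units ?B) = 2\<close> card.infinite by fastforce
  ultimately have Units: "Units ?B = {cl 1, cl (- 1)}"
    using card_subset_eq[OF _ cl_pm_one_Units] cl_one_neq by simp
  let ?gen = "generate (add_monoid ?B) (burnside_basis G ` \<D>)"
  have one_in: "cl 1 \<in> burnside_basis G ` \<D>"
    using D burnside_basis_eq[OF subgroup_self] by (force simp: mark_coset_carrier)
  have "inv\<^bsub>add_monoid ?B\<^esub> (cl 1) \<in> ?gen"
    by (rule generate.inv[OF one_in])
  then have minus_one: "cl (- 1) \<in> ?gen"
    unfolding burnside_ring_def burnside.inv_add_eq[OF burnside.one_in_differences] .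
  have one: "cl 1 \<in> ?gen"
    by (rule generate.incl[OF one_in])
  have mult: "cl 1 \<otimes>\<^bsub>?B\<^esub> cl 1 = \<one>\<^bsub>?B\<^esub>" "cl (- 1) \<otimes>\<^bsub>?B\<^esub> cl (- 1) = \<one>\<^bsub>?B\<^esub>"
    unfolding burnside_ring_def burnside.one_eq
    using burnside.one_in_differences burnside.differences_uminus by (simp_all add: burnside.mult_eq)
  have "Units ?P = Units ?B"
  proof
    show "Units ?P \<subseteq> Units ?B"
      by (rule Units_partial_subset[OF sub])
    show "Units ?B \<subseteq> Units ?P"
      unfolding Units using one minus_one mult by (auto simp: Units_def partial_burnside_ring_def)
  qed
  then show ?thesis
    by (simp add: units_of_def partial_burnside_ring_def)
qed

text \<open>The span consists of the elements \<open>a + b [G/1]\<close>, with mark \<open>a\<close> at \<open>G\<close> and \<open>a + b \<bar>G\<bar>\<close> at the trivial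
  group. For a unit both are \<open>1\<close> or \<open>- 1\<close>, so \<open>\<bar>b\<bar> \<bar>G\<bar> \<le> 2\<close> and \<open>b = 0\<close>.\<close>

lemma partial_units_trivial:
  assumes D: "\<D> \<subseteq> {carrier G, {\<one>}}" and order: "order G > 2"
  shows "Units (partial_burnside_ring G \<D>) \<subseteq> {cl 1, cl (- 1)}"
proof
  let ?m = "mark G (coset_gset G {\<one>})"
  let ?J = "{(\<lambda>A. a + b * ?m A) | a b. True}"
  have m: "?m \<in> burnside.differences"
    by (rule mark_in_differences[OF finite_coset_gset[OF triv_subgroup]])
  have J: "(\<lambda>A. a + b * ?m A) \<in> burnside.differences" for a b
  proof -
    have "(\<lambda>A. a + b * ?m A) = (\<lambda>A. a * 1 A) + (\<lambda>A. b * ?m A)"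
      by (simp add: fun_eq_iff)
    then show ?thesis
      using burnside.differences_add[OF differences_scale[OF burnside.one_in_differences]
          differences_scale[OF m]] by simp
  qed
  have m_carrier: "?m (carrier G) = 0"
  proof -
    obtain g where g: "g \<in> carrier G" "g \<noteq> \<one>"
      using order card_mono[of "{\<one>}" "carrier G"] by (force simp: order_def)
    have "\<exists>k\<in>carrier G. inv a \<otimes> k \<otimes> a \<noteq> \<one>" if a: "a \<in> carrier G" for a
    proof -
      have "inv a \<otimes> (a \<otimes> g \<otimes> inv a) \<otimes> a = g"
        using conjugation_is_surj[of "inv a" g] a g(1) by simp
      then show ?thesis
        using a g by (intro bexI[of _ "a \<otimes> g \<otimes> inv a"]) auto
    qed
    then have "{a \<in> carrier G. \<forall>k\<in>carrier G \<inter> carrier G. inv a \<otimes> k \<otimes> a \<in> {\<one>}} = {}"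
      by auto
    then show ?thesis
      using mark_coset_gset[OF triv_subgroup, of "carrier G"] by (simp only: card.empty) simp
  qed
  have m_one: "?m {\<one>} = int (order G)"
  proof -
    have "{a \<in> carrier G. \<forall>k\<in>{\<one>} \<inter> carrier G. inv a \<otimes> k \<otimes> a \<in> {\<one>}} = carrier G"
      by auto
    then show ?thesis
      using mark_coset_gset[OF triv_subgroup, of "{\<one>}"] by (simp add: order_def)
  qed
  have D_sub: "subgroup H G" if "H \<in> \<D>" for H
    using that D subgroup_self triv_subgroup by auto
  have basis: "burnside_basis G ` \<D> = cl ` (\<lambda>H. mark G (coset_gset G H)) ` \<D>"
    by (rule burnside_basis_image[OF D_sub])
  have marks_J: "(\<lambda>H. mark G (coset_gset G H)) ` \<D> \<subseteq> ?J"
  proof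
    fix f assume "f \<in> (\<lambda>H. mark G (coset_gset G H)) ` \<D>"
    then have "f = 1 \<or> f = ?m"
      using D mark_coset_carrier by auto
    then have "f = (\<lambda>A. 1 + 0 * ?m A) \<or> f = (\<lambda>A. 0 + 1 * ?m A)"
      by (auto simp: fun_eq_iff)
    then show "f \<in> ?J"
      by blast
  qed
  have J0: "0 \<in> ?J"
    by (simp add: zero_fun_def) (metis add.right_neutral mult_zero_left)
  have Jadd: "v + w \<in> ?J" if "v \<in> ?J" "w \<in> ?J" for v w
  proof -
    obtain a b a' b' where "v = (\<lambda>A. a + b * ?m A)" "w = (\<lambda>A. a' + b' * ?m A)"
      using \<open>v \<in> ?J\<close> \<open>w \<in> ?J\<close> by blast
    then have "v + w = (\<lambda>A. (a + a') + (b + b') * ?m A)"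
      by (simp add: fun_eq_iff algebra_simps)
    then show ?thesis
      by blast
  qed
  have Juminus: "- v \<in> ?J" if "v \<in> ?J" for v
  proof -
    obtain a b where "v = (\<lambda>A. a + b * ?m A)"
      using \<open>v \<in> ?J\<close> by blast
    then have "- v = (\<lambda>A. (- a) + (- b) * ?m A)"
      by (simp add: fun_eq_iff algebra_simps)
    then show ?thesis
      by blast
  qed
  have gen: "x \<in> cl ` ?J"
    if "x \<in> generate (add_monoid (burnside_ring G)) (burnside_basis G ` \<D>)" for x
    using that[unfolded burnside_ring_def basis]
    by (rule burnside.generate_in_subgroup[OF _ marks_J _ J0 Jadd Juminus]) (use J in auto)
  fix x assume x: "x \<in> Units (partial_burnside_ring G \<D>)"
  then have "x \<in> cl ` ?J"
    using gen by (simp add: Units_def partial_burnside_ring_def)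
  then obtain a b where ab: "x = cl (\<lambda>A. a + b * ?m A)"
    by blast
  have "x \<in> Units (burnside_ring G)"
    using x Units_partial_subset[OF D_sub] by blast
  then obtain v w where vw: "v * w = 1" "x = cl v" "v \<in> burnside.differences"
    unfolding burnside_ring_def by (elim burnside.UnitsE)
  then have v: "v = (\<lambda>A. a + b * ?m A)"
    using ab J inj_onD[OF burnside.inj_diff_class] by blast
  have sign: "a = 1 \<or> a = - 1" "a + b * int (order G) = 1 \<or> a + b * int (order G) = - 1"
    using unit_marks[OF vw(1), of "carrier G"] unit_marks[OF vw(1), of "{\<one>}"]
    by (simp_all add: v m_carrier m_one)
  have "b = 0"
  proof (rule ccontr)
    assume "b \<noteq> 0"
    then have "\<bar>b * int (order G)\<bar> \<ge> int (order G)"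
      by (simp add: abs_mult) (metis mult_le_cancel_right1 of_nat_less_0_iff zero_less_abs_iff int_one_le_iff_zero_less)
    then show False
      using sign order by linarith
  qed
  then have "v = 1 \<or> v = - 1"
    using sign(1) by (auto simp: v fun_eq_iff)
  then show "x \<in> {cl 1, cl (- 1)}"
    using vw(2) by auto
qed

lemma comm_group_if_generated_by_one:
  assumes g: "g \<in> carrier G" and gen: "generate G {g} = carrier G"
  shows "comm_group G"
proof (rule group_comm_groupI)
  fix x y assume "x \<in> carrier G" "y \<in> carrier G"
  then obtain i j :: int where "x = g [^] i" "y = g [^] j"
    using generate_pow[OF g] gen by auto
  then show "x \<otimes> y = y \<otimes> x"
    using g by (simp add: int_pow_mult[symmetric] add.commute)
qed

text \<open>If \<open>\<langle>g, H\<rangle> = G\<close> for some \<open>g\<close> that normalises \<open>H\<close>, then \<open>H\<close> is normal. So \<open>H\<close> is trivial or \<open>G\<close>, and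
  in the first case \<open>g\<close> alone would generate \<open>G\<close>, which is not abelian. Hence every congruence sum for
  \<open>H \<noteq> G\<close> is zero, and the one for \<open>H = G\<close> is \<open>\<bar>L\<bar>\<close>.\<close>

lemma whole_group_indicator_in_ghost:
  assumes simple: "simple_group G" and nonabelian: "\<not> comm_group G"
  shows "(\<lambda>A. if generate G (A \<inter> carrier G) = carrier G then 1 else 0) \<in> ghost" (is "?e \<in> ghost")
proof (rule ghostI)
  interpret simple_group G by fact
  show "?e (generate G (A \<inter> carrier G)) = ?e A" for A
  proof -
    have K: "subgroup (generate G (A \<inter> carrier G)) G"
      by (rule generate_is_subgroup) auto
    then have "generate G (A \<inter> carrier G) \<inter> carrier G = generate G (A \<inter> carrier G)"
      using subgroup.subset by blast
    then show ?thesis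
      using generate_of_subgroup[OF K] by simp
  qed
  have e: "?e H = (if H = carrier G then 1 else 0)" if "subgroup H G" for H
    using generate_of_subgroup[OF that] subgroup.subset[OF that] by (simp add: Int_absorb2)
  show "?e ((\<lambda>h. g \<otimes> h \<otimes> inv g) ` H) = ?e H" if g: "g \<in> carrier G" and H: "subgroup H G" for g H
  proof -
    have "K = carrier G \<longleftrightarrow> card K = card (carrier G)" if "subgroup K G" for K
      using card_subset_eq[OF fin subgroup.subset[OF that]] by auto
    then show ?thesis
      using e[OF H] e[OF subgroup_conjugate[OF H g]] subgroup_conjugate[OF H g] H
        card_conjugate[OF subgroup.subset[OF H] g] by simp
  qed
  show "int (card L) dvd (\<Sum>g\<in>L. ?e (insert g H))"
    if H: "subgroup H G" and L: "subgroup L G"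
      and normal: "\<And>g h. g \<in> L \<Longrightarrow> h \<in> H \<Longrightarrow> inv g \<otimes> h \<otimes> g \<in> H" for H L
  proof (cases "H = carrier G")
    case True
    have "?e (insert g H) = 1" if "g \<in> L" for g
      using True subgroup.mem_carrier[OF L that] generate_of_subgroup[OF subgroup_self]
      by (simp add: insert_absorb)
    then show ?thesis
      by simp
  next
    case False
    have "generate G (insert g H) \<noteq> carrier G" if g: "g \<in> L" for g
    proof
      assume gen: "generate G (insert g H) = carrier G"
      have gG: "g \<in> carrier G"
        using subgroup.mem_carrier[OF L g] .
      have "g \<in> Norm H"
        using gG normal[OF g] by (simp add: Norm_def)
      then have "carrier G \<subseteq> Norm H"
        using generate_subgroup_incl[OF _ subgroup_Norm[OF H]] subgroup_subset_Norm[OF H] gen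
        by (metis insert_subset)
      then have "inv x \<otimes> h \<otimes> x \<in> H" if "x \<in> carrier G" "h \<in> H" for x h
        using that by (auto simp: Norm_def)
      then have "x \<otimes> h \<otimes> inv x \<in> H" if "x \<in> carrier G" "h \<in> H" for x h
        using that by (metis inv_closed inv_inv)
      then have "H \<lhd> G"
        using H by (simp add: normal_inv_iff)
      then have "H = {\<one>}"
        using no_real_normal_subgroup False by blast
      moreover have "generate G {g, \<one>} \<subseteq> generate G {g}"
        using generate_subgroup_incl[OF _ generate_is_subgroup[of "{g}"], of "{g, \<one>}"] gG
          generate.incl[of g "{g}" G] generate.one[of G "{g}"] by simp
      ultimately have "generate G {g} = carrier G"
        using gen generate_incl[of "{g}"] gG by auto
      then show False
        using comm_group_if_generated_by_one[OF gG] nonabelian by blast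
    qed
    moreover have "insert g H \<inter> carrier G = insert g H" if "g \<in> L" for g
      using subgroup.mem_carrier[OF L that] subgroup.subset[OF H] by blast
    ultimately show ?thesis
      by simp
  qed
qed

text \<open>The indicator \<open>e\<close> of the whole group is an idempotent, so \<open>1 - 2 e\<close> squares to \<open>1\<close>; it is \<open>- 1\<close> at \<open>G\<close>
  and \<open>1\<close> at the trivial group.\<close>

lemma nontrivial_unit:
  assumes simple: "simple_group G" and nonabelian: "\<not> comm_group G"
  shows "\<exists>u. u \<in> Units (burnside_ring G) \<and> u \<noteq> cl 1 \<and> u \<noteq> cl (- 1)"
proof -
  interpret simple_group G by fact
  let ?e = "(\<lambda>A. if generate G (A \<inter> carrier G) = carrier G then 1 else 0) :: 'a set \<Rightarrow> int"
  let ?u = "1 + (- ?e + - ?e)"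
  have e: "?e \<in> burnside.differences"
    using whole_group_indicator_in_ghost[OF assms] differences_eq_ghost by blast
  have u: "?u \<in> burnside.differences"
    by (intro burnside.differences_add burnside.differences_uminus burnside.one_in_differences e)
  have "?u * ?u = 1"
    by (simp add: fun_eq_iff)
  then have unit: "cl ?u \<in> Units (burnside_ring G)"
    unfolding burnside_ring_def by (rule burnside.diff_class_in_Units[OF u u])
  have "?u (carrier G) = - 1"
    using generate_of_subgroup[OF subgroup_self] by simp
  then have "?u \<noteq> 1"
    by (metis one_fun_apply one_neq_neg_one)
  moreover have "?u {\<one>} = 1"
    using generate_of_subgroup[OF triv_subgroup] simple_not_triv by simp
  then have "?u \<noteq> - 1"
    by (metis one_fun_apply one_neq_neg_one uminus_apply)
  ultimately have "cl ?u \<noteq> cl 1" "cl ?u \<noteq> cl (- 1)"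
    using inj_onD[OF burnside.inj_diff_class _ u] burnside.one_in_differences
      burnside.differences_uminus by blast+
  then show ?thesis
    using unit by blast
qed

text \<open>A count: the Burnside ring has at least three units, the partial one at most two.\<close>

lemma not_iso_partial_units:
  assumes simple: "simple_group G" and nonabelian: "\<not> comm_group G" and odd: "odd (order G)"
    and D: "\<D> \<subseteq> {carrier G, {\<one>}}"
  shows "\<not> units_of (burnside_ring G) \<cong> units_of (partial_burnside_ring G \<D>)"
proof
  interpret simple_group G by fact
  assume "units_of (burnside_ring G) \<cong> units_of (partial_burnside_ring G \<D>)"
  then obtain f where f: "bij_betw f (Units (burnside_ring G)) (Units (partial_burnside_ring G \<D>))"
    by (auto simp: is_iso_def iso_def units_of_def)
  have "order G > 2"
    using order_gt_one odd by (cases "order G = 2") auto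
  note P = partial_units_trivial[OF D this]
  obtain u where u: "u \<in> Units (burnside_ring G)" "u \<noteq> cl 1" "u \<noteq> cl (- 1)"
    using nontrivial_unit[OF simple nonabelian] by blast
  have "finite (Units (burnside_ring G))"
    using bij_betw_finite[OF f] P finite_subset by blast
  moreover have "{u, cl 1, cl (- 1)} \<subseteq> Units (burnside_ring G)"
    using u(1) cl_pm_one_Units by blast
  ultimately have "card {u, cl 1, cl (- 1)} \<le> card (Units (burnside_ring G))"
    by (rule card_mono)
  also have "\<dots> = card (Units (partial_burnside_ring G \<D>))"
    by (rule bij_betw_same_card[OF f])
  also have "\<dots> \<le> card {cl 1, cl (- 1)}"
    by (rule card_mono[OF _ P]) simp
  finally show False
    using u cl_one_neq by simp
qed

end

text \<open>Every non-trivial subgroup of \<open>G\<close> has odd order and thus a quotient of prime order; the kernels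
  are the prime-index steps along which a unit is constant.\<close>

lemma burnside_units_trivial:
  fixes G :: "'a monoid"
  assumes simple_comm: "\<And>Q :: 'a monoid. group Q \<Longrightarrow> finite (carrier Q) \<Longrightarrow> odd (order Q) \<Longrightarrow>
      simple_group Q \<Longrightarrow> comm_group Q"
    and "group G" "finite (carrier G)" "odd (order G)"
  shows "order (units_of (burnside_ring G)) = 2"
proof -
  interpret group G by fact
  interpret finite_group G
    by standard fact
  have chain: "\<exists>N p. subgroup N G \<and> N \<subseteq> H \<and>
      (\<forall>g\<in>H. \<forall>h\<in>N. inv\<^bsub>G\<^esub> g \<otimes>\<^bsub>G\<^esub> h \<otimes>\<^bsub>G\<^esub> g \<in> N) \<and> prime p \<and> card H = p * card N"
    if H: "subgroup H G" and nontrivial: "H \<noteq> {\<one>\<^bsub>G\<^esub>}" for H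
  proof -
    let ?H = "G\<lparr>carrier := H\<rparr>"
    have order: "order ?H = card H"
      by (simp add: order_def)
    have "card H dvd order G"
      using card_subgroup_dvd[OF H subgroup_self subgroup.subset[OF H]] by (simp add: order_def)
    then have "odd (order ?H)"
      using \<open>odd (order G)\<close> order dvd_trans by metis
    moreover have "order ?H > 1"
    proof -
      have "card {\<one>\<^bsub>G\<^esub>} < card H"
        using nontrivial subgroup.one_closed[OF H] finite_subgroup[OF H]
        by (intro psubset_card_mono) auto
      then show ?thesis
        by (simp add: order)
    qed
    moreover have "group ?H" "finite (carrier ?H)"
      using subgroup_imp_group[OF H] finite_subgroup[OF H] by simp_all
    ultimately obtain P :: "'a monoid" and \<phi> where "group P" "prime (order P)" "\<phi> \<in> hom ?H P"
      "\<phi> ` carrier ?H = carrier P"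
      using prime_order_quotient_exists[OF simple_comm, of ?H] by blast
    then show ?thesis
      using prime_index_subgroup[OF H] by simp
  qed
  have "Units (burnside_ring G) \<subseteq> {cl 1, cl (- 1)}"
  proof
    fix x assume "x \<in> Units (burnside_ring G)"
    then obtain v w where v: "v \<in> burnside.differences" "v * w = 1" "x = cl v"
      unfolding burnside_ring_def by (elim burnside.UnitsE)
    have "v = 1 \<or> v = - 1"
    proof (rule sign_valued_ghost_const[OF _ _ \<open>odd (order G)\<close> chain])
      show "v \<in> ghost"
        using v(1) differences_subset_ghost by blast
      show "v A = 1 \<or> v A = - 1" for A
        by (rule unit_marks[OF v(2)])
    qed
    then show "x \<in> {cl 1, cl (- 1)}"
      using v(3) by auto
  qed
  then have "Units (burnside_ring G) = {cl 1, cl (- 1)}"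
    using cl_pm_one_Units by blast
  then show ?thesis
    using cl_one_neq by (simp add: order_def units_of_def)
qed

text \<open>Otherwise the derived subgroup, being normal, is trivial, and all commutators vanish.\<close>

lemma (in group) derived_simple_nonabelian:
  assumes "simple_group G" "\<not> comm_group G"
  shows "derived G (carrier G) = carrier G"
proof (rule ccontr)
  interpret simple_group G by fact
  assume "derived G (carrier G) \<noteq> carrier G"
  then have trivial: "derived G (carrier G) = {\<one>}"
    using no_real_normal_subgroup[OF derived_self_is_normal] by blast
  have "comm_group G"
  proof (rule group_comm_groupI)
    fix x y assume xy: "x \<in> carrier G" "y \<in> carrier G"
    then have "x \<otimes> y \<otimes> inv x \<otimes> inv y \<in> derived G (carrier G)"
      unfolding derived_def by (intro generate.incl) blast
    then have "x \<otimes> y \<otimes> inv x \<otimes> inv y = \<one>"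
      using trivial by blast
    then have "x \<otimes> y \<otimes> inv x = y"
      using xy inv_equality[of "x \<otimes> y \<otimes> inv x" "inv y"] by simp
    then show "x \<otimes> y = y \<otimes> x"
      using xy inv_solve_right'[of "x \<otimes> y" y x] by (metis inv_solve_right m_closed)
  qed
  then show False
    using assms(2) by blast
qed

section \<open>The equivalence\<close>

theorem theorem4p2:
  shows
    "let
       S1 = (\<forall>G :: 'a monoid. group G \<and> finite (carrier G) \<longrightarrow>
               (simple_group G \<and> \<not> comm_group G \<longrightarrow> even (order G)));
       S2 = (\<forall>G :: 'a monoid. group G \<and> finite (carrier G) \<longrightarrow>
               (odd (order G) \<longrightarrow> order (units_of (burnside_ring G)) = 2));
       S3 = (\<forall>G :: 'a monoid. group G \<and> finite (carrier G) \<longrightarrow>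
               (odd (order G) \<longrightarrow>
                  units_of (burnside_ring G) \<cong>
                  units_of (partial_burnside_ring G (normal_subgroups G))));
       S4 = (\<forall>G :: 'a monoid. group G \<and> finite (carrier G) \<longrightarrow>
               (odd (order G) \<longrightarrow>
                  units_of (burnside_ring G) \<cong>
                  units_of (partial_burnside_ring G (subgroups_over_derived G))))
     in (S1 \<longleftrightarrow> S2) \<and> (S2 \<longleftrightarrow> S3) \<and> (S3 \<longleftrightarrow> S4)"
proof -
  let ?units = "\<lambda>G :: 'a monoid. units_of (burnside_ring G)"
  let ?partial = "\<lambda>(G :: 'a monoid) \<D>. units_of (partial_burnside_ring G \<D>)"
  define S1 where "S1 \<longleftrightarrow> (\<forall>G :: 'a monoid. group G \<and> finite (carrier G) \<longrightarrow>
    (simple_group G \<and> \<not> comm_group G \<longrightarrow> even (order G)))"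
  define S2 where "S2 \<longleftrightarrow> (\<forall>G :: 'a monoid. group G \<and> finite (carrier G) \<longrightarrow>
    (odd (order G) \<longrightarrow> order (?units G) = 2))"
  define S3 where "S3 \<longleftrightarrow> (\<forall>G :: 'a monoid. group G \<and> finite (carrier G) \<longrightarrow>
    (odd (order G) \<longrightarrow> ?units G \<cong> ?partial G (normal_subgroups G)))"
  define S4 where "S4 \<longleftrightarrow> (\<forall>G :: 'a monoid. group G \<and> finite (carrier G) \<longrightarrow>
    (odd (order G) \<longrightarrow> ?units G \<cong> ?partial G (subgroups_over_derived G)))"
  have S1_S2: S2 if S1
    unfolding S2_def
  proof (intro allI impI)
    fix G :: "'a monoid" assume "group G \<and> finite (carrier G)" "odd (order G)"
    moreover have "comm_group Q"
      if "group Q" "finite (carrier Q)" "odd (order Q)" "simple_group Q" for Q :: "'a monoid"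
      using \<open>S1\<close> that unfolding S1_def by blast
    ultimately show "order (?units G) = 2"
      using burnside_units_trivial by blast
  qed
  have S2_partial: "?units G \<cong> ?partial G \<D>"
    if S2 "group G" "finite (carrier G)" "odd (order G)" "carrier G \<in> \<D>"
      "\<And>H. H \<in> \<D> \<Longrightarrow> subgroup H G" for G :: "'a monoid" and \<D>
  proof -
    interpret finite_group G
      using that by (simp add: finite_group_def finite_group_axioms_def)
    have "order (?units G) = 2"
      using that unfolding S2_def by blast
    then show ?thesis
      using Units_partial_eq[OF _ that(5,6)] iso_set_refl unfolding is_iso_def by (metis empty_iff)
  qed
  have S2_S3: S3 if S2
    unfolding S3_def
  proof (intro allI impI)
    fix G :: "'a monoid" assume G: "group G \<and> finite (carrier G)" "odd (order G)"
    then interpret group G by blast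
    have "carrier G \<lhd> G"
      using subgroup_self by (simp add: normal_inv_iff)
    then show "?units G \<cong> ?partial G (normal_subgroups G)"
      using G by (intro S2_partial[OF that]) (auto simp: normal_subgroups_def normal_imp_subgroup)
  qed
  have S2_S4: S4 if S2
    unfolding S4_def
  proof (intro allI impI)
    fix G :: "'a monoid" assume G: "group G \<and> finite (carrier G)" "odd (order G)"
    then interpret group G by blast
    show "?units G \<cong> ?partial G (subgroups_over_derived G)"
      using G subgroup_self derived_in_carrier[of "carrier G"]
      by (intro S2_partial[OF that]) (auto simp: subgroups_over_derived_def)
  qed
  have S3_S1: S1 if S3
    unfolding S1_def
  proof (intro allI impI)
    fix G :: "'a monoid"
    assume G: "group G \<and> finite (carrier G)" and simple: "simple_group G \<and> \<not> comm_group G"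
    interpret finite_group G
      using G by (simp add: finite_group_def finite_group_axioms_def)
    have "normal_subgroups G \<subseteq> {carrier G, {\<one>\<^bsub>G\<^esub>}}"
      using simple_group.no_real_normal_subgroup simple by (auto simp: normal_subgroups_def)
    then show "even (order G)"
      using not_iso_partial_units simple that G unfolding S3_def by blast
  qed
  have S4_S1: S1 if S4
    unfolding S1_def
  proof (intro allI impI)
    fix G :: "'a monoid"
    assume G: "group G \<and> finite (carrier G)" and simple: "simple_group G \<and> \<not> comm_group G"
    interpret finite_group G
      using G by (simp add: finite_group_def finite_group_axioms_def)
    \<comment> \<open>Here \<open>G' = G\<close>, so that \<open>G\<close> is the only member.\<close>
    have "subgroups_over_derived G \<subseteq> {carrier G, {\<one>\<^bsub>G\<^esub>}}"
      using derived_simple_nonabelian simple subgroup.subset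
      by (fastforce simp: subgroups_over_derived_def)
    then show "even (order G)"
      using not_iso_partial_units simple that G unfolding S4_def by blast
  qed
  have "(S1 \<longleftrightarrow> S2) \<and> (S2 \<longleftrightarrow> S3) \<and> (S3 \<longleftrightarrow> S4)"
    using S1_S2 S2_S3 S2_S4 S3_S1 S4_S1 by blast
  then show ?thesis
    unfolding Let_def S1_def S2_def S3_def S4_def .
qed

end
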